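(* Let $\mu$ be a compactly supported probability measure on $\mathbb{R}$ and let $\mu=\mu_1\boxplus\mu_2$ with $\mu_1,\mu_2$ probability measures on $\mathbb{R}$. Then $\mathrm{diam}(\mathrm{supp}(\mu_i))\le \mathrm{diam}(\mathrm{supp}(\mu))$ for $i=1,2$, with equality if and only if one of the $\mu_i$ is a Dirac mass.
   Context: $\boxplus$ is free additive convolution. $\mathrm{supp}(\mu)$ is the complement of the largest open $\mu$-null set; $\mathrm{diam}(\sigma)=\sup_{x,y\in\sigma}|x-y|$. *)

theory Defs
  imports "HOL-Probability.Probability"
begin

definition real_prob_measure :: "real measure \<Rightarrow> bool" where
  "real_prob_measure M \<longleftrightarrow> prob_space M \<and> sets M = sets borel"

definition supp :: "real measure \<Rightarrow> real set" where
  "supp M = - \<Union>{U. open U \<and> emeasure M U = 0}"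

definition diam :: "real set \<Rightarrow> ereal" where
  "diam S = (SUP p\<in>S \<times> S. ereal (dist (fst p) (snd p)))"

definition cauchy_transform :: "real measure \<Rightarrow> complex \<Rightarrow> complex" where
  "cauchy_transform M z = (\<integral>t. 1 / (z - complex_of_real t) \<partial>M)"

definition F_transform :: "real measure \<Rightarrow> complex \<Rightarrow> complex" where
  "F_transform M z = 1 / cauchy_transform M z"

definition Gamma_cone :: "real \<Rightarrow> real \<Rightarrow> complex set" where
  "Gamma_cone \<alpha> \<beta> = {z. Im z > \<beta> \<and> \<bar>Re z\<bar> < \<alpha> * Im z}"

text \<open>The Voiculescu transform of M is defined on Gamma(alpha,beta) via the inverse of
  F restricted to a cone Gamma(alpha',beta') on which F is univalent
  (Bercovici--Voiculescu 1993).\<close>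
definition voiculescu_on :: "real measure \<Rightarrow> real \<Rightarrow> real \<Rightarrow> real \<Rightarrow> real \<Rightarrow> bool" where
  "voiculescu_on M \<alpha> \<beta> \<alpha>' \<beta>' \<longleftrightarrow> \<alpha>' > 0 \<and> \<beta>' > 0 \<and>
     inj_on (F_transform M) (Gamma_cone \<alpha>' \<beta>') \<and>
     Gamma_cone \<alpha> \<beta> \<subseteq> F_transform M ` Gamma_cone \<alpha>' \<beta>'"

definition voiculescu :: "real measure \<Rightarrow> real \<Rightarrow> real \<Rightarrow> complex \<Rightarrow> complex" where
  "voiculescu M \<alpha>' \<beta>' z = inv_into (Gamma_cone \<alpha>' \<beta>') (F_transform M) z - z"

definition free_add_conv_of :: "real measure \<Rightarrow> real measure \<Rightarrow> real measure \<Rightarrow> bool" where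
  "free_add_conv_of M M1 M2 \<longleftrightarrow>
     (\<exists>\<alpha> \<beta> a b a1 b1 a2 b2. \<alpha> > 0 \<and> \<beta> > 0 \<and>
        voiculescu_on M \<alpha> \<beta> a b \<and> voiculescu_on M1 \<alpha> \<beta> a1 b1 \<and> voiculescu_on M2 \<alpha> \<beta> a2 b2 \<and>
        (\<forall>z\<in>Gamma_cone \<alpha> \<beta>. voiculescu M a b z = voiculescu M1 a1 b1 z + voiculescu M2 a2 b2 z))"

definition is_dirac :: "real measure \<Rightarrow> bool" where
  "is_dirac M \<longleftrightarrow> (\<exists>c. M = return borel c)"

end

theory Submission
  imports Defs "HOL-Complex_Analysis.Complex_Analysis"
begin

text \<open>
  On the upper half-plane there are holomorphic subordination functions with
  \<open>F\<^sub>1(\<omega>\<^sub>1(z)) = F\<^sub>2(\<omega>\<^sub>2(z)) = F(z)\<close>, \<open>\<omega>\<^sub>1(z) + \<omega>\<^sub>2(z) = z + F(z)\<close> and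
  \<open>Im \<omega>\<^sub>i(z) \<ge> Im z\<close>. Hence \<open>u(z) = \<omega>\<^sub>1(z) - z\<close> satisfies \<open>0 \<le> Im u(z) \<le> Im (F(z) - z)\<close>, so
  if \<open>\<mu>\<close> lives on \<open>[a, b]\<close>, then \<open>u\<close> extends by reflection across \<open>\<real> - [a, b]\<close>, where it is real
  and increasing on both half-lines, and it has the same limit at \<open>+\<infinity>\<close> and \<open>-\<infinity>\<close>. Thus
  \<open>u(x) \<le> u(y)\<close> for \<open>y < a\<close> and \<open>b < x\<close>. Since \<open>G\<^sub>1 \<circ> \<omega>\<^sub>1 = G\<close> is real on \<open>\<real> - [a, b]\<close>, the support of
  \<open>\<mu>\<^sub>1\<close> avoids the points \<open>\<omega>\<^sub>1(x)\<close> and is contained in \<open>[y + u(y), x + u(x)]\<close>, whose length is at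
  most \<open>x - y\<close>. Equality of the diameters forces \<open>u\<close> to be constant, and then \<open>F\<^sub>2\<close> is a translation,
  which means that \<open>\<mu>\<^sub>2\<close> is a Dirac mass. Conversely, convolving with a Dirac mass can be undone by
  another one, so the diameter inequality applies in both directions.
\<close>

section \<open>Cauchy transforms\<close>

lemma real_prob_measure_iff: "real_prob_measure M \<longleftrightarrow> real_distribution M"
  by (auto simp: real_prob_measure_def real_distribution_def real_distribution_axioms_def)

abbreviation upper_half_plane :: "complex set" ("\<H>") where
  "\<H> \<equiv> {z. 0 < Im z}"

lemma open_uhp: "open \<H>"
  by (rule open_halfspace_Im_gt)

lemma connected_uhp: "connected \<H>"
  by (rule convex_connected) (rule convex_halfspace_Im_gt)

text \<open>One family of domains serves two purposes: \<open>K = UNIV\<close> leaves the non-real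
  numbers, where every Cauchy transform is analytic, and \<open>K = {a..b}\<close> also keeps the
  real points off an interval that carries the measure.\<close>

definition off_real :: "real set \<Rightarrow> complex set" where
  "off_real K = {z. Im z = 0 \<longrightarrow> Re z \<notin> K}"

lemma open_off_real:
  assumes "closed K" shows "open (off_real K)"
proof -
  have "off_real K = - {w. Im w = 0 \<and> Re w \<in> K}" by (auto simp: off_real_def)
  moreover have "closed {w. Im w = 0 \<and> Re w \<in> K}"
    using continuous_closed_vimage[OF assms(1), of Re]
    by (auto intro!: closed_Collect_conj closed_Collect_eq continuous_intros simp: vimage_def)
  ultimately show ?thesis by auto
qed

text \<open>The constant \<open>d\<close> works for all \<open>w\<close> near \<open>z\<close> at
  once, as the difference quotient and the local bounds near real points require.\<close>

lemma off_real_gap: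
  assumes "closed K" "z \<in> off_real K"
  obtains d where "0 < d" "\<And>w t. w \<in> ball z d \<Longrightarrow> t \<in> K \<Longrightarrow> d \<le> cmod (w - of_real t)"
proof -
  obtain e where e: "0 < e" "ball z e \<subseteq> off_real K"
    using open_off_real[OF assms(1)] assms(2) open_contains_ball by blast
  show thesis
  proof (rule that[of "e/2"])
    fix w t assume w: "w \<in> ball z (e/2)" and t: "t \<in> K"
    have "of_real t \<notin> ball z e" using e(2) t by (auto simp: off_real_def)
    then have "e \<le> dist z (of_real t)" by simp
    also have "\<dots> \<le> dist z w + dist w (of_real t)" by (rule dist_triangle)
    finally show "e/2 \<le> cmod (w - of_real t)" using w by (simp add: dist_norm)
  qed (use e in simp)
qed

lemma uhp_subset_off_real: "\<H> \<subseteq> off_real K"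
  by (auto simp: off_real_def)

section \<open>Analyticity, sign and size of the Cauchy transform and its reciprocal\<close>

context real_distribution
begin

text \<open>The bias-variance decomposition. With \<open>c\<close> equal to the mean it yields
  \<open>norm_cauchy_transform_le\<close>; with \<open>c = 1 / z\<close> it controls the transform
  at infinity.\<close>

lemma variance_identity:
  fixes f :: "real \<Rightarrow> complex"
  assumes f: "integrable M f" and f2: "integrable M (\<lambda>t. (cmod (f t))\<^sup>2)"
  shows "(\<integral>t. (cmod (f t - c))\<^sup>2 \<partial>M) =
           (\<integral>t. (cmod (f t))\<^sup>2 \<partial>M) - (cmod (\<integral>t. f t \<partial>M))\<^sup>2 + (cmod ((\<integral>t. f t \<partial>M) - c))\<^sup>2"
proof -
  have 1: "(cmod (f t - c))\<^sup>2 = (cmod (f t))\<^sup>2 - 2 * Re (cnj c * f t) + (cmod c)\<^sup>2" for t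
    unfolding cmod_power2 by (simp add: algebra_simps power2_eq_square)
  have 2: "integrable M (\<lambda>t. Re (cnj c * f t))"
    using f by (intro integrable_Re integrable_mult_right)
  have "(\<integral>t. (cmod (f t - c))\<^sup>2 \<partial>M)
      = (\<integral>t. (cmod (f t))\<^sup>2 \<partial>M) - 2 * (\<integral>t. Re (cnj c * f t) \<partial>M) + (cmod c)\<^sup>2"
    unfolding 1 using f2 2 prob_space by (simp del: times_complex.sel)
  also have "(\<integral>t. Re (cnj c * f t) \<partial>M) = Re (cnj c * (\<integral>t. f t \<partial>M))"
    using f by (subst integral_Re) (auto simp del: times_complex.sel)
  finally show ?thesis
    unfolding cmod_power2 by (simp add: algebra_simps power2_eq_square)
qed

context
  fixes K :: "real set"
  assumes K: "closed K" "AE t in M. t \<in> K"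
begin

lemma AE_resolvent_gap:
  assumes "z \<in> off_real K"
  obtains d where "0 < d" "\<And>w. w \<in> ball z d \<Longrightarrow> AE t in M. d \<le> cmod (w - of_real t)"
proof -
  obtain d where d: "0 < d" "\<And>w t. w \<in> ball z d \<Longrightarrow> t \<in> K \<Longrightarrow> d \<le> cmod (w - of_real t)"
    using off_real_gap[OF K(1) assms] by blast
  show thesis
    by (rule that[OF d(1)]) (use K(2) d(2) in auto)
qed

lemma integrable_resolvent_powers:
  assumes "z \<in> off_real K"
  shows "integrable M (\<lambda>t. 1 / (z - complex_of_real t))"
    and "integrable M (\<lambda>t. 1 / (z - complex_of_real t)\<^sup>2)"
    and "integrable M (\<lambda>t. (cmod (1 / (z - complex_of_real t)))\<^sup>2)"
proof -
  obtain d where d: "0 < d" "\<And>w. w \<in> ball z d \<Longrightarrow> AE t in M. d \<le> cmod (w - of_real t)"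
    using AE_resolvent_gap[OF assms] by blast
  have AEd: "AE t in M. d \<le> cmod (z - of_real t)" using d by simp
  show "integrable M (\<lambda>t. 1 / (z - complex_of_real t))"
  proof (rule integrable_const_bound[of _ "1/d"])
    show "AE t in M. norm (1 / (z - complex_of_real t)) \<le> 1/d"
      using AEd by eventually_elim (use d(1) in \<open>auto simp: norm_divide intro!: divide_left_mono mult_pos_pos\<close>)
  qed measurable
  have *: "AE t in M. (1 / cmod (z - of_real t))\<^sup>2 \<le> (1/d)\<^sup>2"
    using AEd by eventually_elim (use d(1) in \<open>auto intro!: power_mono divide_left_mono mult_pos_pos\<close>)
  show "integrable M (\<lambda>t. 1 / (z - complex_of_real t)\<^sup>2)"
  proof (rule integrable_const_bound[of _ "(1/d)\<^sup>2"])
    show "AE t in M. norm (1 / (z - complex_of_real t)\<^sup>2) \<le> (1/d)\<^sup>2"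
      using * by eventually_elim (simp add: norm_divide norm_power power_divide)
  qed measurable
  show "integrable M (\<lambda>t. (cmod (1 / (z - complex_of_real t)))\<^sup>2)"
  proof (rule integrable_const_bound[of _ "(1/d)\<^sup>2"])
    show "AE t in M. norm ((cmod (1 / (z - complex_of_real t)))\<^sup>2) \<le> (1/d)\<^sup>2"
      using * by eventually_elim (simp add: norm_divide)
  qed measurable
qed

text \<open>The difference quotient minus the candidate derivative is the integral of
  \<open>(w - z) / ((w - t) * (z - t)\<^sup>2)\<close>. Since |w - t| and |z - t| are almost surely
  at least \<open>d\<close>, this is at most |w - z| / d^3.\<close>

lemma cauchy_transform_has_derivative:
  assumes z: "z \<in> off_real K"
  shows "(cauchy_transform M has_field_derivative - (\<integral>t. 1 / (z - complex_of_real t)\<^sup>2 \<partial>M)) (at z)"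
proof -
  obtain d where d: "0 < d" "\<And>w. w \<in> ball z d \<Longrightarrow> AE t in M. d \<le> cmod (w - of_real t)"
    using AE_resolvent_gap[OF z] by blast
  have "AE t in M. d \<le> cmod (z - of_real t)" using d by simp
  define D where "D = - (\<integral>t. 1 / (z - complex_of_real t)\<^sup>2 \<partial>M)"
  have bound: "cmod ((cauchy_transform M w - cauchy_transform M z) / (w - z) - D) \<le> cmod (w - z) / d ^ 3"
    if w: "w \<in> ball z d" "w \<noteq> z" "w \<in> off_real K" for w
  proof -
    have eq: "(cauchy_transform M w - cauchy_transform M z) / (w - z) - D
       = (\<integral>t. (1 / (w - complex_of_real t) - 1 / (z - complex_of_real t)) / (w - z)
            + 1 / (z - complex_of_real t)\<^sup>2 \<partial>M)"
      using integrable_resolvent_powers[OF z] integrable_resolvent_powers[OF w(3)]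
      by (simp add: D_def cauchy_transform_def)
    have "cmod \<dots> \<le> (\<integral>t. cmod ((1 / (w - complex_of_real t) - 1 / (z - complex_of_real t)) / (w - z)
            + 1 / (z - complex_of_real t)\<^sup>2) \<partial>M)"
      by (rule integral_norm_bound)
    also have "\<dots> \<le> (\<integral>t. cmod (w - z) / d ^ 3 \<partial>M)"
    proof (rule integral_mono_AE)
      show "integrable M (\<lambda>t. cmod ((1 / (w - complex_of_real t) - 1 / (z - complex_of_real t)) / (w - z)
            + 1 / (z - complex_of_real t)\<^sup>2))"
        using integrable_resolvent_powers[OF z] integrable_resolvent_powers[OF w(3)] by auto
      show "AE t in M. cmod ((1 / (w - complex_of_real t) - 1 / (z - complex_of_real t)) / (w - z)
            + 1 / (z - complex_of_real t)\<^sup>2) \<le> cmod (w - z) / d ^ 3"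
        using d(2)[OF w(1)] \<open>AE t in M. d \<le> cmod (z - of_real t)\<close>
      proof eventually_elim
        case (elim t)
        have nz: "w - complex_of_real t \<noteq> 0" "z - complex_of_real t \<noteq> 0" "w - z \<noteq> 0"
          using elim d(1) w(2) by auto
        have id: "(1 / a - 1 / b) / (a - b) + 1 / b\<^sup>2 = (a - b) / (a * b\<^sup>2)"
          if "a \<noteq> 0" "b \<noteq> 0" "a - b \<noteq> 0" for a b :: complex
          using that by (simp add: divide_simps) (simp add: algebra_simps power2_eq_square)
        have "(1 / (w - complex_of_real t) - 1 / (z - complex_of_real t)) / (w - z)
            + 1 / (z - complex_of_real t)\<^sup>2 = (w - z) / ((w - of_real t) * (z - of_real t)\<^sup>2)"
          using id[OF nz(1,2)] nz(3) by simp
        then have "cmod ((1 / (w - complex_of_real t) - 1 / (z - complex_of_real t)) / (w - z)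
            + 1 / (z - complex_of_real t)\<^sup>2) = cmod (w - z) / (cmod (w - of_real t) * (cmod (z - of_real t))\<^sup>2)"
          by (simp add: norm_divide norm_mult norm_power)
        also have "\<dots> \<le> cmod (w - z) / (d * d\<^sup>2)"
          using elim d(1) by (intro divide_left_mono mult_mono power_mono mult_pos_pos) auto
        finally show ?case by (simp add: power3_eq_cube power2_eq_square mult.assoc)
      qed
    qed auto
    also have "\<dots> = cmod (w - z) / d ^ 3" using prob_space by simp
    finally show ?thesis unfolding eq .
  qed
  have "((\<lambda>w. (cauchy_transform M w - cauchy_transform M z) / (w - z) - D) \<longlongrightarrow> 0) (at z)"
  proof (rule Lim_null_comparison)
    have "\<forall>\<^sub>F w in at z. w \<in> off_real K"
      using eventually_at_topological open_off_real[OF K(1)] z by blast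
    moreover have "\<forall>\<^sub>F w in at z. w \<in> ball z d"
      using eventually_at_ball[OF d(1), of z UNIV] by simp
    moreover have "\<forall>\<^sub>F w in at z. w \<noteq> z" by (simp add: eventually_at_filter)
    ultimately show "\<forall>\<^sub>F w in at z. norm ((cauchy_transform M w - cauchy_transform M z) / (w - z) - D) \<le> cmod (w - z) / d ^ 3"
      by eventually_elim (use bound in auto)
    show "((\<lambda>w. cmod (w - z) / d ^ 3) \<longlongrightarrow> 0) (at z)"
      using d(1) by (auto intro!: tendsto_eq_intros)
  qed
  then show ?thesis
    unfolding has_field_derivative_iff D_def[symmetric] by (simp add: LIM_zero_iff)
qed

lemma cauchy_transform_holomorphic: "cauchy_transform M holomorphic_on off_real K"
  using cauchy_transform_has_derivative
  by (meson field_differentiable_at_within field_differentiable_def holomorphic_on_def)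

text \<open>Pointwise, Im (1 / (z - t)) = - Im z / |z - t|^2. Up to normalisation the integral on
  the right is the Poisson integral of \<open>M\<close> divided by \<open>Im z\<close>.\<close>

lemma Im_cauchy_transform:
  assumes "z \<in> off_real K"
  shows "Im (cauchy_transform M z) = - Im z * (\<integral>t. (cmod (1 / (z - complex_of_real t)))\<^sup>2 \<partial>M)"
proof -
  have "Im (cauchy_transform M z) = (\<integral>t. Im (1 / (z - complex_of_real t)) \<partial>M)"
    unfolding cauchy_transform_def using integrable_resolvent_powers[OF assms] by simp
  also have "\<dots> = (\<integral>t. - Im z * (cmod (1 / (z - complex_of_real t)))\<^sup>2 \<partial>M)"
    by (rule Bochner_Integration.integral_cong)
      (auto simp: Im_divide cmod_power2 norm_divide power_divide)
  finally show ?thesis using integrable_resolvent_powers[OF assms] by simp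
qed

lemma cauchy_transform_variance:
  assumes "z \<in> off_real K"
  shows "(\<integral>t. (cmod (1 / (z - complex_of_real t) - c))\<^sup>2 \<partial>M) =
     (\<integral>t. (cmod (1 / (z - complex_of_real t)))\<^sup>2 \<partial>M) - (cmod (cauchy_transform M z))\<^sup>2
       + (cmod (cauchy_transform M z - c))\<^sup>2"
  unfolding cauchy_transform_def
  using integrable_resolvent_powers[OF assms] by (intro variance_identity)

lemma norm_cauchy_transform_le:
  assumes "z \<in> off_real K"
  shows "(cmod (cauchy_transform M z))\<^sup>2 \<le> (\<integral>t. (cmod (1 / (z - complex_of_real t)))\<^sup>2 \<partial>M)"
proof -
  have "0 \<le> (\<integral>t. (cmod (1 / (z - complex_of_real t) - cauchy_transform M z))\<^sup>2 \<partial>M)"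
    by (rule integral_nonneg_AE) auto
  then show ?thesis
    unfolding cauchy_transform_variance[OF assms] by simp
qed

end

lemma cauchy_transform_Im_neg:
  assumes "0 < Im z"
  shows "Im (cauchy_transform M z) < 0"
proof -
  have z: "z \<in> off_real UNIV" using assms by (auto simp: off_real_def)
  have "0 < (\<integral>t. (cmod (1 / (z - complex_of_real t)))\<^sup>2 \<partial>M)"
  proof (rule integral_less_AE_space[of "\<lambda>_. 0", simplified])
    show "integrable M (\<lambda>t. (cmod (1 / (z - complex_of_real t)))\<^sup>2)"
      using integrable_resolvent_powers(3)[OF _ _ z] by auto
    show "AE t in M. 0 < (cmod (1 / (z - complex_of_real t)))\<^sup>2"
      using assms by (intro AE_I2) auto
    show "emeasure M UNIV \<noteq> 0" using emeasure_space_1 by simp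
  qed
  then show ?thesis
    using Im_cauchy_transform[OF _ _ z] assms by (simp add: mult_pos_pos)
qed

lemma F_transform_holomorphic: "F_transform M holomorphic_on \<H>"
proof -
  have "cauchy_transform M holomorphic_on \<H>"
    using cauchy_transform_holomorphic[of UNIV] uhp_subset_off_real
    by (auto intro: holomorphic_on_subset)
  moreover have "cauchy_transform M z \<noteq> 0" if "z \<in> \<H>" for z
    using cauchy_transform_Im_neg[of z] that by auto
  ultimately show ?thesis
    unfolding F_transform_def[abs_def] by (auto intro!: holomorphic_intros)
qed

lemma Im_F_transform:
  assumes "0 < Im z"
  shows "Im (F_transform M z) =
    Im z * (\<integral>t. (cmod (1 / (z - complex_of_real t)))\<^sup>2 \<partial>M) / (cmod (cauchy_transform M z))\<^sup>2"
proof -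
  have z: "z \<in> off_real UNIV" using assms by (auto simp: off_real_def)
  show ?thesis
    using Im_cauchy_transform[OF _ _ z]
    by (simp add: F_transform_def Im_divide cmod_power2)
qed

text \<open>The quotient in \<open>Im_F_transform\<close> is at least 1, because the mean square of
  the resolvent dominates its squared mean. So F(z) - z maps the upper half-plane into its closure,
  which drives the subordination argument.\<close>

lemma Im_F_transform_ge:
  assumes "0 < Im z"
  shows "Im z \<le> Im (F_transform M z)"
proof -
  have z: "z \<in> off_real UNIV" using assms by (auto simp: off_real_def)
  have pos: "0 < (cmod (cauchy_transform M z))\<^sup>2"
    using cauchy_transform_Im_neg[OF assms] by auto
  show ?thesis
    unfolding Im_F_transform[OF assms] using norm_cauchy_transform_le[OF _ _ z] assms pos
    by (simp add: pos_le_divide_eq)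
qed

end

section \<open>Schwarz--Pick estimates in the half-plane\<close>

text \<open>The quotient |v - p| / |v - cnj p| is the pseudo-hyperbolic distance; this identity
  shows it to be below 1 for two points of the half-plane.\<close>

lemma cmod_diff_cnj_sq: "(cmod (v - cnj p))\<^sup>2 = (cmod (v - p))\<^sup>2 + 4 * Im v * Im p"
  unfolding cmod_power2 by (simp add: power2_eq_square algebra_simps)

lemma cmod_diff_less_cnj:
  assumes "0 < Im v" "0 < Im p"
  shows "cmod (v - p) < cmod (v - cnj p)"
proof -
  have "(cmod (v - p))\<^sup>2 < (cmod (v - cnj p))\<^sup>2"
    unfolding cmod_diff_cnj_sq using assms by simp
  then show ?thesis by (rule power2_less_imp_less) simp
qed

text \<open>The Schwarz lemma, transported by the Cayley maps that send \<open>p\<close> and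
  \<open>f p\<close> to the centre of the disc.\<close>

lemma Schwarz_Pick_uhp_open:
  assumes hol: "f holomorphic_on \<H>" and f: "\<And>z. 0 < Im z \<Longrightarrow> 0 < Im (f z)"
    and p: "0 < Im p" and v: "0 < Im v"
  shows "cmod (f v - f p) * cmod (v - cnj p) \<le> cmod (v - p) * cmod (f v - cnj (f p))"
proof -
  \<comment> \<open>\<open>\<psi>\<close> inverts the Cayley map v -> (v - p) / (v - cnj p), so it
    takes the disc to the half-plane and 0 to \<open>p\<close>.\<close>
  define \<psi> where "\<psi> \<zeta> = (p - cnj p * \<zeta>) / (1 - \<zeta>)" for \<zeta>
  define g where "g \<zeta> = (f (\<psi> \<zeta>) - f p) / (f (\<psi> \<zeta>) - cnj (f p))" for \<zeta>
  have Im\<psi>: "0 < Im (\<psi> \<zeta>)" if "cmod \<zeta> < 1" for \<zeta>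
  proof -
    have "\<zeta> \<noteq> 1" using that by auto
    then have pos: "0 < (cmod (1 - \<zeta>))\<^sup>2" by simp
    have "(cmod \<zeta>)\<^sup>2 < 1" using that by (simp add: power_less_one_iff abs_square_less_1)
    moreover have "Im (\<psi> \<zeta>) = Im p * (1 - (cmod \<zeta>)\<^sup>2) / (cmod (1 - \<zeta>))\<^sup>2"
      unfolding \<psi>_def Im_divide cmod_power2
      by (simp add: algebra_simps power2_eq_square)
    ultimately show ?thesis using p pos by simp
  qed
  have nz: "f (\<psi> \<zeta>) - cnj (f p) \<noteq> 0" if "cmod \<zeta> < 1" for \<zeta>
    using f[OF Im\<psi>[OF that]] f[OF p] by (metis add.inverse_neutral cmod_diff_less_cnj norm_eq_zero norm_not_less_zero)
  have hol\<psi>: "\<psi> holomorphic_on ball 0 1"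
    unfolding \<psi>_def by (intro holomorphic_intros) auto
  have holf\<psi>: "(\<lambda>\<zeta>. f (\<psi> \<zeta>)) holomorphic_on ball 0 1"
    using holomorphic_on_compose_gen[OF hol\<psi> hol] Im\<psi> by (force simp: o_def)
  have holg: "g holomorphic_on ball 0 1"
    unfolding g_def by (intro holomorphic_intros holf\<psi>) (use nz in auto)
  have g0: "g 0 = 0" by (simp add: g_def \<psi>_def)
  have g1: "norm (g \<zeta>) < 1" if "norm \<zeta> < 1" for \<zeta>
    using cmod_diff_less_cnj[OF f[OF Im\<psi>[OF that]] f[OF p]] nz[OF that]
    by (simp add: g_def norm_divide)
  define \<zeta> where "\<zeta> = (v - p) / (v - cnj p)"
  have lt: "cmod (v - p) < cmod (v - cnj p)" using cmod_diff_less_cnj[OF v p] .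
  then have nzv: "v - cnj p \<noteq> 0" by auto
  have \<zeta>1: "norm \<zeta> < 1" using lt nzv by (simp add: \<zeta>_def norm_divide divide_less_eq_1)
  have "1 - \<zeta> = (p - cnj p) / (v - cnj p)" "p - cnj p * \<zeta> = v * (p - cnj p) / (v - cnj p)"
    using nzv by (simp_all add: \<zeta>_def field_simps)
  moreover have "p - cnj p \<noteq> 0" using p by (simp add: complex_eq_iff)
  ultimately have \<psi>\<zeta>: "\<psi> \<zeta> = v" using nzv by (simp add: \<psi>_def)
  have "norm (g \<zeta>) \<le> norm \<zeta>" using Schwarz_Lemma(1)[OF holg g0 g1 \<zeta>1] .
  then have "cmod (f v - f p) / cmod (f v - cnj (f p)) \<le> cmod (v - p) / cmod (v - cnj p)"
    unfolding g_def \<psi>\<zeta> by (simp add: \<zeta>_def norm_divide)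
  moreover have "0 < cmod (f v - cnj (f p))" using nz[OF \<zeta>1] \<psi>\<zeta> by simp
  moreover have "0 < cmod (v - cnj p)" using nzv by simp
  ultimately show ?thesis by (simp add: field_simps)
qed

text \<open>Real values of \<open>f\<close> are now allowed: apply the open case to f + i \<eta> and
  let \<eta> tend to 0. The product form stays meaningful where \<open>f v - cnj (f p)\<close>
  vanishes.\<close>

lemma Schwarz_Pick_uhp:
  assumes hol: "f holomorphic_on \<H>" and f: "\<And>z. 0 < Im z \<Longrightarrow> 0 \<le> Im (f z)"
    and p: "0 < Im p" and v: "0 < Im v"
  shows "cmod (f v - f p) * cmod (v - cnj p) \<le> cmod (v - p) * cmod (f v - cnj (f p))"
proof -
  have *: "cmod (f v - f p) * cmod (v - cnj p) \<le> cmod (v - p) * (cmod (f v - cnj (f p)) + 2 * \<eta>)"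
    if "0 < \<eta>" for \<eta> :: real
  proof -
    have "cmod ((f v + \<i> * \<eta>) - (f p + \<i> * \<eta>)) * cmod (v - cnj p)
        \<le> cmod (v - p) * cmod ((f v + \<i> * \<eta>) - cnj (f p + \<i> * \<eta>))"
      by (rule Schwarz_Pick_uhp_open[of "\<lambda>z. f z + \<i> * \<eta>", OF _ _ p v])
        (use hol f that in \<open>auto intro!: holomorphic_intros add_nonneg_pos\<close>)
    also have "cmod ((f v + \<i> * \<eta>) - cnj (f p + \<i> * \<eta>)) \<le> cmod (f v - cnj (f p)) + 2 * \<eta>"
    proof -
      have "(f v + \<i> * \<eta>) - cnj (f p + \<i> * \<eta>) = (f v - cnj (f p)) + 2 * \<i> * \<eta>"
        by (simp add: algebra_simps)
      moreover have "cmod (2 * \<i> * \<eta>) = 2 * \<eta>" using that by (simp add: norm_mult)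
      ultimately show ?thesis by (metis norm_triangle_ineq)
    qed
    finally show ?thesis by (simp add: mult_left_mono)
  qed
  have "((\<lambda>\<eta>. cmod (v - p) * (cmod (f v - cnj (f p)) + 2 * \<eta>)) \<longlongrightarrow>
      cmod (v - p) * (cmod (f v - cnj (f p)) + 2 * 0)) (at_right 0)"
    by (intro tendsto_intros)
  then have "cmod (f v - f p) * cmod (v - cnj p) \<le> cmod (v - p) * (cmod (f v - cnj (f p)) + 2 * 0)"
  proof (rule tendsto_lowerbound)
    show "\<forall>\<^sub>F \<eta> in at_right 0. cmod (f v - f p) * cmod (v - cnj p) \<le> cmod (v - p) * (cmod (f v - cnj (f p)) + 2 * \<eta>)"
      using * by (auto simp: eventually_at_filter)
  qed simp
  then show ?thesis by simp
qed

text \<open>Divide the Schwarz-Pick inequality by |v - z| and let v tend to \<open>z\<close>: the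
  right side tends to |f z - cnj (f z)| / |z - cnj z|, the quotient of the imaginary parts.\<close>

lemma norm_deriv_uhp_le:
  assumes hol: "f holomorphic_on \<H>" and f: "\<And>z. 0 < Im z \<Longrightarrow> 0 \<le> Im (f z)"
    and z: "0 < Im z"
  shows "cmod (deriv f z) \<le> Im (f z) / Im z"
proof -
  have df: "(f has_field_derivative deriv f z) (at z)"
    using holomorphic_derivI[OF hol open_uhp, of z] z by simp
  have lim1: "((\<lambda>v. cmod ((f v - f z) / (v - z))) \<longlongrightarrow> cmod (deriv f z)) (at z)"
    using df unfolding has_field_derivative_iff by (intro tendsto_norm)
  have lim2: "((\<lambda>v. cmod (f v - cnj (f z)) / cmod (v - cnj z)) \<longlongrightarrow>
      cmod (f z - cnj (f z)) / cmod (z - cnj z)) (at z)"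
  proof (intro tendsto_intros)
    show "(f \<longlongrightarrow> f z) (at z)" using df DERIV_isCont isContD by blast
    show "cmod (z - cnj z) \<noteq> 0" using z by (simp add: complex_eq_iff)
  qed
  have "cmod (deriv f z) \<le> cmod (f z - cnj (f z)) / cmod (z - cnj z)"
  proof (rule tendsto_le[OF _ lim2 lim1])
    have "\<forall>\<^sub>F v in at z. v \<in> \<H>"
      using open_uhp z eventually_at_topological by blast
    moreover have "\<forall>\<^sub>F v in at z. v \<noteq> z" by (simp add: eventually_at_filter)
    ultimately show "\<forall>\<^sub>F v in at z. cmod ((f v - f z) / (v - z)) \<le> cmod (f v - cnj (f z)) / cmod (v - cnj z)"
    proof eventually_elim
      case (elim v)
      have "cmod (v - z) < cmod (v - cnj z)" using cmod_diff_less_cnj elim z by simp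
      then have "0 < cmod (v - cnj z)" by (metis norm_ge_zero order.strict_trans1)
      then show ?case
        using Schwarz_Pick_uhp[OF hol f z, of v] elim by (simp add: norm_divide field_simps)
    qed
  qed simp
  also have "\<dots> = Im (f z) / Im z"
    using f[OF z] z by (simp add: complex_diff_cnj norm_mult)
  finally show ?thesis .
qed

text \<open>Since \<open>T\<close> stays above height \<epsilon>, the Schwarz-Pick inequality also
  holds for T - i \<epsilon>. In terms of \<open>T\<close> this is a strict contraction towards
  \<open>p\<close>, with a factor that is uniform on each pseudo-hyperbolic disc about
  \<open>p\<close>.\<close>

lemma funpow_uhp_tendsto_fixpoint:
  assumes hol: "T holomorphic_on \<H>" and \<epsilon>: "0 < \<epsilon>" and T: "\<And>z. 0 < Im z \<Longrightarrow> \<epsilon> \<le> Im (T z)"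
    and p: "0 < Im p" "T p = p" and v: "0 < Im v"
  shows "(\<lambda>n. (T ^^ n) v) \<longlonglongrightarrow> p"
proof -
  define x where "x n = (T ^^ n) v" for n
  have x0: "x 0 = v" and xS: "x (Suc n) = T (x n)" for n by (simp_all add: x_def)
  have Imx: "0 < Im (x n)" for n
    by (induction n) (use v \<epsilon> T xS x0 in \<open>auto intro: less_le_trans\<close>)
  have Imp: "\<epsilon> \<le> Im p" using T[OF p(1)] p(2) by simp
  have hol': "(\<lambda>z. T z - \<i> * \<epsilon>) holomorphic_on \<H>" using hol by (intro holomorphic_intros)
  have step: "cmod (T z - p) * cmod (z - cnj p) \<le> cmod (z - p) * cmod (T z - cnj p - 2 * \<i> * \<epsilon>)"
    if "0 < Im z" for z
  proof -
    have "cmod ((T z - \<i> * \<epsilon>) - (T p - \<i> * \<epsilon>)) * cmod (z - cnj p)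
        \<le> cmod (z - p) * cmod ((T z - \<i> * \<epsilon>) - cnj (T p - \<i> * \<epsilon>))"
      by (rule Schwarz_Pick_uhp[OF hol' _ p(1) that]) (use T in simp)
    moreover have "(T z - \<i> * \<epsilon>) - cnj (T p - \<i> * \<epsilon>) = T z - cnj p - 2 * \<i> * \<epsilon>"
      by (simp add: p(2))
    moreover have "(T z - \<i> * \<epsilon>) - (T p - \<i> * \<epsilon>) = T z - p" by (simp add: p(2))
    ultimately show ?thesis by (simp only:)
  qed
  \<comment> \<open>With w = T z - cnj p, expand |w - 2 i \<epsilon>|^2 = |w|^2 - 4 \<epsilon> Im w
    + 4 \<epsilon>^2 and use that Im w is at least 2 \<epsilon>.\<close>
  have drop: "(cmod (T z - cnj p - 2 * \<i> * \<epsilon>))\<^sup>2 \<le> (cmod (T z - cnj p))\<^sup>2 - 4 * \<epsilon>\<^sup>2" if "0 < Im z" for z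
  proof -
    have "(cmod (T z - cnj p - 2 * \<i> * \<epsilon>))\<^sup>2
        = (cmod (T z - cnj p))\<^sup>2 - 4 * \<epsilon> * (Im (T z) + Im p) + 4 * \<epsilon>\<^sup>2"
      unfolding cmod_power2 by (simp add: power2_eq_square algebra_simps)
    moreover have "2 * \<epsilon> \<le> Im (T z) + Im p" using T[OF that] Imp by simp
    then have "\<epsilon> * (2 * \<epsilon>) \<le> \<epsilon> * (Im (T z) + Im p)" using \<epsilon> by (intro mult_left_mono) auto
    ultimately show ?thesis by (simp add: power2_eq_square)
  qed
  \<comment> \<open>\<open>r\<close> is the initial pseudo-hyperbolic distance to \<open>p\<close>.
    The iterates stay in the disc of that radius, where \<open>B\<close> bounds |z - cnj p| and
    \<open>k\<close> bounds the factor by which the squared distance shrinks.\<close>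
  define r where "r = cmod (v - p) / cmod (v - cnj p)"
  have lt: "cmod (v - p) < cmod (v - cnj p)" using cmod_diff_less_cnj v p by simp
  then have vp: "0 < cmod (v - cnj p)" by (metis norm_ge_zero order.strict_trans1)
  have r: "0 \<le> r" "r < 1" using lt vp by (auto simp: r_def)
  define B where "B = 2 * Im p / (1 - r)"
  have B: "cmod (z - cnj p) \<le> B" if "cmod (z - p) \<le> r * cmod (z - cnj p)" for z
  proof -
    have "cmod (z - cnj p) \<le> cmod (z - p) + cmod (p - cnj p)"
      by (metis diff_add_cancel add_diff_eq norm_triangle_ineq)
    also have "cmod (p - cnj p) = 2 * Im p" using p(1) by (simp add: complex_diff_cnj norm_mult)
    finally have "(1 - r) * cmod (z - cnj p) \<le> 2 * Im p" using that by (simp add: algebra_simps)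
    then show ?thesis using r by (simp add: B_def field_simps)
  qed
  have Bpos: "0 < B" using p r by (simp add: B_def)
  define k where "k = 1 - 4 * \<epsilon>\<^sup>2 / B\<^sup>2"
  have k1: "k < 1" using \<epsilon> Bpos by (simp add: k_def)
  have nonneg_step: "cmod (T z - p) \<le> r * cmod (T z - cnj p) \<and> 0 \<le> k \<and>
      (cmod (T z - p))\<^sup>2 * (cmod (z - cnj p))\<^sup>2 \<le> k * (cmod (z - p))\<^sup>2 * (cmod (T z - cnj p))\<^sup>2"
    if z: "0 < Im z" and zr: "cmod (z - p) \<le> r * cmod (z - cnj p)" for z
  proof -
    have "cmod (z - p) < cmod (z - cnj p)" using cmod_diff_less_cnj z p by simp
    then have zp: "0 < cmod (z - cnj p)" by (metis norm_ge_zero order.strict_trans1)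
    have TI: "0 < Im (T z)" using T[OF z] \<epsilon> by simp
    have "cmod (T z - p) < cmod (T z - cnj p)" using cmod_diff_less_cnj TI p by simp
    then have Tp: "0 < cmod (T z - cnj p)" by (metis norm_ge_zero order.strict_trans1)
    have "(cmod (T z - cnj p - 2 * \<i> * \<epsilon>))\<^sup>2 \<le> (cmod (T z - cnj p))\<^sup>2"
      using drop[OF z] by (smt (verit) zero_le_power2)
    then have "cmod (T z - cnj p - 2 * \<i> * \<epsilon>) \<le> cmod (T z - cnj p)"
      by (rule power2_le_imp_le) simp
    then have "cmod (T z - p) * cmod (z - cnj p) \<le> cmod (z - p) * cmod (T z - cnj p)"
      using step[OF z] by (meson mult_left_mono norm_ge_zero order_trans)
    also have "\<dots> \<le> (r * cmod (z - cnj p)) * cmod (T z - cnj p)"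
      using zr by (intro mult_right_mono) auto
    finally have "cmod (T z - p) * cmod (z - cnj p) \<le> (r * cmod (T z - cnj p)) * cmod (z - cnj p)"
      by (simp add: mult_ac)
    then have 1: "cmod (T z - p) \<le> r * cmod (T z - cnj p)" using zp by simp
    have "(cmod (T z - cnj p))\<^sup>2 \<le> B\<^sup>2" using B[OF 1] by (intro power_mono) auto
    then have "\<epsilon>\<^sup>2 * (cmod (T z - cnj p))\<^sup>2 \<le> \<epsilon>\<^sup>2 * B\<^sup>2" by (intro mult_left_mono) auto
    then have "4 * \<epsilon>\<^sup>2 / B\<^sup>2 * (cmod (T z - cnj p))\<^sup>2 \<le> 4 * \<epsilon>\<^sup>2"
      using Bpos by (simp add: field_simps)
    then have dk: "(cmod (T z - cnj p - 2 * \<i> * \<epsilon>))\<^sup>2 \<le> k * (cmod (T z - cnj p))\<^sup>2"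
      using drop[OF z] by (simp add: k_def algebra_simps)
    then have "0 \<le> k * (cmod (T z - cnj p))\<^sup>2" by (meson order_trans zero_le_power2)
    then have k0: "0 \<le> k" using Tp by (simp add: zero_le_mult_iff)
    have "(cmod (T z - p) * cmod (z - cnj p))\<^sup>2 \<le> (cmod (z - p) * cmod (T z - cnj p - 2 * \<i> * \<epsilon>))\<^sup>2"
      using step[OF z] by (intro power_mono) auto
    also have "\<dots> \<le> (cmod (z - p))\<^sup>2 * (k * (cmod (T z - cnj p))\<^sup>2)"
      unfolding power_mult_distrib using dk by (intro mult_left_mono) auto
    finally show ?thesis using 1 k0 by (simp add: power_mult_distrib mult_ac)
  qed
  have xr: "cmod (x n - p) \<le> r * cmod (x n - cnj p)" for n
  proof (induction n)
    case 0 then show ?case using vp by (simp add: x0 r_def)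
  next
    case (Suc n) then show ?case using nonneg_step[OF Imx] xS by simp
  qed
  have k0: "0 \<le> k" using nonneg_step[OF Imx xr, of 0] by simp
  have xk: "(cmod (x n - p))\<^sup>2 \<le> k ^ n * (cmod (x n - cnj p))\<^sup>2" for n
  proof (induction n)
    case 0 then show ?case using lt by (simp add: x0 power_mono)
  next
    case (Suc n)
    have "cmod (x n - p) < cmod (x n - cnj p)" using cmod_diff_less_cnj Imx p by simp
    then have zp: "0 < (cmod (x n - cnj p))\<^sup>2"
      by (metis norm_ge_zero order.strict_trans1 zero_less_power)
    have "(cmod (x (Suc n) - p))\<^sup>2 * (cmod (x n - cnj p))\<^sup>2
        \<le> k * (cmod (x n - p))\<^sup>2 * (cmod (x (Suc n) - cnj p))\<^sup>2"
      using nonneg_step[OF Imx xr, of n] xS by simp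
    also have "\<dots> \<le> k * (k ^ n * (cmod (x n - cnj p))\<^sup>2) * (cmod (x (Suc n) - cnj p))\<^sup>2"
      using Suc k0 by (intro mult_left_mono mult_right_mono) auto
    finally have "(cmod (x (Suc n) - p))\<^sup>2 * (cmod (x n - cnj p))\<^sup>2
       \<le> (k ^ Suc n * (cmod (x (Suc n) - cnj p))\<^sup>2) * (cmod (x n - cnj p))\<^sup>2"
      by (simp add: mult_ac)
    then show ?case using zp by (simp del: power_Suc)
  qed
  \<comment> \<open>Only the ratio of |x n - p| to |x n - cnj p| contracts; the bound
    \<open>B\<close> turns its decay into convergence of the iterates.\<close>
  have "(\<lambda>n. (cmod (x n - p))\<^sup>2) \<longlonglongrightarrow> 0"
  proof (rule Lim_null_comparison)
    show "\<forall>\<^sub>F n in sequentially. norm ((cmod (x n - p))\<^sup>2) \<le> k ^ n * B\<^sup>2"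
    proof (rule always_eventually, rule allI)
      fix n
      have "(cmod (x n - cnj p))\<^sup>2 \<le> B\<^sup>2" using B[OF xr] by (intro power_mono) auto
      then have "k ^ n * (cmod (x n - cnj p))\<^sup>2 \<le> k ^ n * B\<^sup>2" using k0 by (intro mult_left_mono) auto
      then show "norm ((cmod (x n - p))\<^sup>2) \<le> k ^ n * B\<^sup>2" using xk[of n] by simp
    qed
    show "(\<lambda>n. k ^ n * B\<^sup>2) \<longlonglongrightarrow> 0"
      using LIMSEQ_power_zero[of k] k0 k1 by (intro tendsto_mult_left_zero) auto
  qed
  then have "(\<lambda>n. sqrt ((cmod (x n - p))\<^sup>2)) \<longlonglongrightarrow> sqrt 0" by (intro tendsto_intros)
  then have "(\<lambda>n. cmod (x n - p)) \<longlonglongrightarrow> 0" by simp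
  then show ?thesis unfolding x_def by (simp add: tendsto_norm_zero_iff LIM_zero_iff)
qed

section \<open>Reflection across the real line\<close>

lemma real_in_closure_half_ball:
  assumes "y \<in> ball x \<delta>" "0 \<le> Im y"
  shows "y \<in> closure (ball x \<delta> \<inter> \<H>)"
  unfolding closure_approachable
proof (intro allI impI)
  fix e :: real assume e: "0 < e"
  define h where "h = min e (\<delta> - dist x y) / 2"
  have h: "0 < h" "h < e" "h < \<delta> - dist x y" using e assms(1) by (auto simp: h_def min_def)
  have d: "dist (y + \<i> * h) y = h" using h(1) by (simp add: dist_norm norm_mult)
  have "dist x (y + \<i> * h) \<le> dist x y + dist (y + \<i> * h) y" by (metis dist_commute dist_triangle)
  then have "y + \<i> * h \<in> ball x \<delta> \<inter> \<H>" using h assms(2) d by simp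
  then show "\<exists>z\<in>ball x \<delta> \<inter> \<H>. dist z y < e" using d h(2) by (intro bexI[of _ "y + \<i> * h"]) simp
qed

text \<open>By \<open>norm_deriv_uhp_le\<close> the local bound on Im u / Im z bounds the
  derivative, so \<open>u\<close> is Lipschitz on a half-disc and extends continuously to its
  diameter. There Im u tends to 0, so the boundary values are real and Schwarz reflection
  applies.\<close>

lemma uhp_reflection_extension:
  fixes u :: "complex \<Rightarrow> complex"
  assumes S: "open S" "cnj ` S \<subseteq> S" "\<H> \<subseteq> S"
    and hol: "u holomorphic_on \<H>" and Imu: "\<And>z. 0 < Im z \<Longrightarrow> 0 \<le> Im (u z)"
    and loc: "\<And>x. complex_of_real x \<in> S \<Longrightarrow>
      \<exists>\<delta>>0. \<exists>C. \<forall>z\<in>ball (complex_of_real x) \<delta> \<inter> \<H>. Im (u z) \<le> C * Im z"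
  obtains U where "U holomorphic_on S" "\<And>z. 0 < Im z \<Longrightarrow> U z = u z"
    "\<And>z. z \<in> S \<Longrightarrow> U (cnj z) = cnj (U z)"
proof -
  \<comment> \<open>The boundary value is a limit from the whole half-plane, so the extensions
    obtained on overlapping half-discs agree automatically.\<close>
  define V where "V z = (if 0 < Im z then u z else Lim (at z within \<H>) u)" for z
  have local_ext: "\<exists>\<delta>>0. continuous_on (ball (complex_of_real x) \<delta> \<inter> {z. 0 \<le> Im z}) V \<and> Im (V (of_real x)) = 0"
    if x: "complex_of_real x \<in> S" for x
  proof -
    obtain \<delta> C where \<delta>: "0 < \<delta>" and C: "\<And>z. z \<in> ball (complex_of_real x) \<delta> \<inter> \<H> \<Longrightarrow> Im (u z) \<le> C * Im z"
      using loc[OF x] by blast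
    define B where "B = ball (complex_of_real x) \<delta> \<inter> \<H>"
    have convB: "convex B" unfolding B_def by (intro convex_Int convex_ball convex_halfspace_Im_gt)
    have lip: "norm (u z - u w) \<le> C * norm (z - w)" if "z \<in> B" "w \<in> B" for z w
    proof (rule field_differentiable_bound[OF convB _ _ that])
      fix v assume v: "v \<in> B"
      then have Imv: "0 < Im v" by (simp add: B_def)
      show "(u has_field_derivative deriv u v) (at v within B)"
        using holomorphic_derivI[OF hol open_uhp] Imv by (simp add: has_field_derivative_at_within)
      have "cmod (deriv u v) \<le> Im (u v) / Im v" by (rule norm_deriv_uhp_le[OF hol Imu Imv])
      also have "\<dots> \<le> C" using C[of v] v Imv by (simp add: B_def pos_divide_le_eq)
      finally show "cmod (deriv u v) \<le> C" .
    qed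
    \<comment> \<open>A Lipschitz constant has to be nonnegative, which is not known of
      \<open>C\<close>.\<close>
    have "(max C 0)-lipschitz_on B u"
    proof (rule lipschitz_onI)
      fix z w assume "z \<in> B" "w \<in> B"
      then have "norm (u z - u w) \<le> C * norm (z - w)" by (rule lip)
      also have "\<dots> \<le> max C 0 * norm (z - w)" by (intro mult_right_mono) auto
      finally show "dist (u z) (u w) \<le> max C 0 * dist z w" by (simp add: dist_norm)
    qed simp
    then have "uniformly_continuous_on B u" by (rule lipschitz_on_uniformly_continuous)
    then obtain g where g: "uniformly_continuous_on (closure B) g" "\<And>z. z \<in> B \<Longrightarrow> u z = g z"
      by (rule uniformly_continuous_on_extension_on_closure) blast
    have contg: "continuous_on (closure B) g" by (rule uniformly_continuous_imp_continuous[OF g(1)])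
    have lims: "(u \<longlongrightarrow> g y) (at y within \<H>)" "at y within \<H> \<noteq> bot"
      if y: "y \<in> ball (complex_of_real x) \<delta>" "Im y = 0" for y
    proof -
      have yc: "y \<in> closure B" unfolding B_def by (rule real_in_closure_half_ball) (use y in auto)
      have atB: "at y within B = at y within \<H>"
        by (rule at_within_nhd[of _ "ball (complex_of_real x) \<delta>"]) (use y in \<open>auto simp: B_def\<close>)
      have "(g \<longlongrightarrow> g y) (at y within B)"
        by (rule tendsto_within_subset[OF _ closure_subset]) (use contg yc in \<open>simp add: continuous_on_def\<close>)
      then have "(u \<longlongrightarrow> g y) (at y within B)"
        by (rule Lim_transform_eventually) (auto simp: eventually_at_filter g(2))
      then show "(u \<longlongrightarrow> g y) (at y within \<H>)" by (simp add: atB)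
      have "y \<notin> B" using y(2) by (simp add: B_def)
      then have "y islimpt B" using yc by (simp add: closure_def)
      then show "at y within \<H> \<noteq> bot" by (simp add: trivial_limit_within flip: atB)
    qed
    have Vg: "V y = g y" if y: "y \<in> ball (complex_of_real x) \<delta> \<inter> {z. 0 \<le> Im z}" for y
    proof (cases "0 < Im y")
      case True then show ?thesis using y g(2)[of y] by (simp add: V_def B_def)
    next
      case False
      then have "Im y = 0" using y by simp
      then show ?thesis using lims[of y] y by (simp add: V_def tendsto_Lim)
    qed
    have "continuous_on (ball (complex_of_real x) \<delta> \<inter> {z. 0 \<le> Im z}) V"
    proof (rule continuous_on_eq[OF continuous_on_subset[OF contg]])
      show "ball (complex_of_real x) \<delta> \<inter> {z. 0 \<le> Im z} \<subseteq> closure B"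
        unfolding B_def using real_in_closure_half_ball by blast
    qed (use Vg in auto)
    moreover have "Im (V (of_real x)) = 0"
    proof -
      have xb: "of_real x \<in> ball (complex_of_real x) \<delta>" "Im (complex_of_real x) = 0" using \<delta> by auto
      have "((\<lambda>z. Im (u z)) \<longlongrightarrow> 0) (at (of_real x) within \<H>)"
      proof (rule tendsto_sandwich)
        show "\<forall>\<^sub>F z in at (of_real x) within \<H>. 0 \<le> Im (u z)"
          using Imu by (auto simp: eventually_at_filter)
        have "\<forall>\<^sub>F z in at (of_real x) within \<H>. z \<in> B"
          unfolding eventually_at_topological using \<delta>
          by (intro exI[of _ "ball (complex_of_real x) \<delta>"]) (auto simp: B_def)
        then show "\<forall>\<^sub>F z in at (of_real x) within \<H>. Im (u z) \<le> C * Im z"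
          by eventually_elim (use C in \<open>auto simp: B_def\<close>)
        have "((\<lambda>z. C * Im z) \<longlongrightarrow> C * Im (complex_of_real x)) (at (of_real x) within \<H>)"
          by (intro tendsto_intros)
        then show "((\<lambda>z. C * Im z) \<longlongrightarrow> 0) (at (of_real x) within \<H>)" by simp
      qed simp
      moreover have "((\<lambda>z. Im (u z)) \<longlongrightarrow> Im (g (of_real x))) (at (of_real x) within \<H>)"
        using lims(1)[OF xb] by (intro tendsto_intros)
      ultimately have "Im (g (of_real x)) = 0" using tendsto_unique[OF lims(2)[OF xb]] by blast
      then show ?thesis using Vg[of "of_real x"] xb by simp
    qed
    ultimately show ?thesis using \<delta> by blast
  qed
  \<comment> \<open>Continuity is local: on the real line it comes from \<open>local_ext\<close>,
    and above it \<open>V\<close> is \<open>u\<close>.\<close>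
  have contV: "continuous_on (S \<inter> {z. 0 \<le> Im z}) V"
    unfolding continuous_on_eq_continuous_within
  proof
    fix z assume z: "z \<in> S \<inter> {z. 0 \<le> Im z}"
    have "\<exists>N. open N \<and> z \<in> N \<and> continuous_on (N \<inter> {z. 0 \<le> Im z}) V"
    proof (cases "Im z = 0")
      case True
      then have "z = of_real (Re z)" by (simp add: complex_eq_iff)
      then show ?thesis using local_ext[of "Re z"] z by (metis Int_iff centre_in_ball open_ball)
    next
      case False
      have "continuous_on (\<H> \<inter> {z. 0 \<le> Im z}) V"
        by (rule continuous_on_eq[OF continuous_on_subset[OF holomorphic_on_imp_continuous_on[OF hol]]])
          (auto simp: V_def)
      then show ?thesis using False z open_uhp by (intro exI[of _ "\<H>"]) auto
    qed
    then obtain N where N: "open N" "z \<in> N" "continuous_on (N \<inter> {z. 0 \<le> Im z}) V" by blast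
    then have "continuous (at z within N \<inter> {z. 0 \<le> Im z}) V"
      using z by (simp add: continuous_on_eq_continuous_within)
    moreover have "at z within N \<inter> {z. 0 \<le> Im z} = at z within S \<inter> {z. 0 \<le> Im z}"
      by (rule at_within_nhd[of _ "N \<inter> S"]) (use N z S in auto)
    ultimately show "continuous (at z within S \<inter> {z. 0 \<le> Im z}) V" by simp
  qed
  have Vreal: "V z \<in> \<real>" if "z \<in> S" "z \<in> \<real>" for z
    using local_ext[of "Re z"] that by (auto simp: complex_is_Real_iff elim!: Reals_cases)
  define U where "U z = (if 0 \<le> Im z then V z else cnj (V (cnj z)))" for z
  show thesis
  proof (rule that)
    show "U holomorphic_on S"
      unfolding U_def
    proof (rule Schwarz_reflection[OF S(1,2) _ contV Vreal])
      have "V holomorphic_on \<H>" by (rule holomorphic_transform[OF hol]) (simp add: V_def)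
      then show "V holomorphic_on S \<inter> \<H>" by (rule holomorphic_on_subset) auto
    qed
    show "U z = u z" if "0 < Im z" for z using that by (simp add: U_def V_def)
    show "U (cnj z) = cnj (U z)" if z: "z \<in> S" for z
    proof (cases "Im z = 0")
      case True
      then have "cnj z = z" "z \<in> \<real>" by (auto simp: complex_eq_iff complex_is_Real_iff)
      then show ?thesis using Vreal[OF z] True by (simp add: U_def Reals_cnj_iff)
    qed (auto simp: U_def)
  qed
qed

text \<open>Compute the complex derivative at a real point t along two directions. Along the real
  line its real part is the derivative of Re U; along the positive imaginary direction it is the
  limit of Im U(t + i h) / h, which is nonnegative.\<close>

lemma Re_mono_on_reals:
  fixes U :: "complex \<Rightarrow> complex"
  assumes S: "open S" and hol: "U holomorphic_on S" and ImU: "\<And>z. 0 < Im z \<Longrightarrow> 0 \<le> Im (U z)"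
    and xy: "x \<le> y" and sub: "\<And>t. x \<le> t \<Longrightarrow> t \<le> y \<Longrightarrow> complex_of_real t \<in> S \<and> Im (U (of_real t)) = 0"
  shows "Re (U (of_real x)) \<le> Re (U (of_real y))"
proof (rule DERIV_nonneg_imp_nondecreasing[OF xy])
  fix t assume "x \<le> t" "t \<le> y"
  then have t: "complex_of_real t \<in> S" "Im (U (of_real t)) = 0" using sub by auto
  have "(U has_field_derivative deriv U (of_real t)) (at (of_real t))"
    using holomorphic_derivI[OF hol S t(1)] by simp
  then have lim: "((\<lambda>h. (U (of_real t + h) - U (of_real t)) / h) \<longlongrightarrow> deriv U (of_real t)) (at 0)"
    by (simp add: DERIV_def)
  have "((\<lambda>h. (U (of_real t + of_real h) - U (of_real t)) / of_real h) \<longlongrightarrow> deriv U (of_real t)) (at (0::real))"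
    by (rule filterlim_compose[OF lim])
      (auto simp: filterlim_at eventually_at_filter intro!: tendsto_eq_intros)
  then have "((\<lambda>h. Re ((U (of_real t + of_real h) - U (of_real t)) / of_real h)) \<longlongrightarrow> Re (deriv U (of_real t))) (at (0::real))"
    by (rule tendsto_Re)
  then have "DERIV (\<lambda>t. Re (U (complex_of_real t))) t :> Re (deriv U (of_real t))"
    by (simp add: DERIV_def)
  moreover have "((\<lambda>h. (U (of_real t + \<i> * of_real h) - U (of_real t)) / (\<i> * of_real h)) \<longlongrightarrow> deriv U (of_real t)) (at_right (0::real))"
    by (rule filterlim_compose[OF lim])
      (auto simp: filterlim_at eventually_at_filter intro!: tendsto_eq_intros)
  then have "((\<lambda>h. Re ((U (of_real t + \<i> * of_real h) - U (of_real t)) / (\<i> * of_real h))) \<longlongrightarrow> Re (deriv U (of_real t))) (at_right (0::real))"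
    by (rule tendsto_Re)
  then have "0 \<le> Re (deriv U (of_real t))"
  proof (rule tendsto_lowerbound)
    show "\<forall>\<^sub>F h in at_right 0. 0 \<le> Re ((U (of_real t + \<i> * of_real h) - U (of_real t)) / (\<i> * of_real h))"
      unfolding eventually_at_filter
    proof (intro always_eventually allI impI)
      fix h :: real assume "h \<noteq> 0" "h \<in> {0<..}"
      then have h: "0 < h" by simp
      have "Re ((U (of_real t + \<i> * of_real h) - U (of_real t)) / (\<i> * of_real h)) = Im (U (of_real t + \<i> * of_real h)) / h"
        using h t(2) by (simp add: Re_divide power2_eq_square)
      then show "0 \<le> Re ((U (of_real t + \<i> * of_real h) - U (of_real t)) / (\<i> * of_real h))"
        using ImU[of "of_real t + \<i> * of_real h"] h by simp
    qed
  qed simp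
  ultimately show "\<exists>D. DERIV (\<lambda>t. Re (U (complex_of_real t))) t :> D \<and> 0 \<le> D" by blast
qed

section \<open>Subordination functions\<close>

text \<open>
  For \<open>w \<in> D\<close> the value \<open>v1\<close> is a fixed point of \<open>T w\<close>, \<open>T w v = w + h2 (w + h1 v)\<close> with
  \<open>hi v = Fi v - v\<close>, hence the limit of the iterates of \<open>T w\<close>. These iterates form a normal family in \<open>w\<close>,
  so a subsequence converges on the whole half-plane and continues \<open>v1\<close> analytically.
\<close>
lemma uhp_subordination:
  assumes F: "F holomorphic_on \<H>"
    and F1: "F1 holomorphic_on \<H>" "\<And>z. 0 < Im z \<Longrightarrow> Im z \<le> Im (F1 z)"
    and F2: "F2 holomorphic_on \<H>" "\<And>z. 0 < Im z \<Longrightarrow> Im z \<le> Im (F2 z)"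
    and D: "open D" "D \<noteq> {}" "D \<subseteq> \<H>"
    and inv: "\<And>w. w \<in> D \<Longrightarrow> \<exists>v1 v2. 0 < Im v1 \<and> 0 < Im v2 \<and> F1 v1 = F w \<and> F2 v2 = F w \<and> v1 + v2 = w + F w"
  obtains w1 w2 where "w1 holomorphic_on \<H>" "w2 holomorphic_on \<H>"
    "\<And>z. 0 < Im z \<Longrightarrow> Im z \<le> Im (w1 z)" "\<And>z. 0 < Im z \<Longrightarrow> Im z \<le> Im (w2 z)"
    "\<And>z. 0 < Im z \<Longrightarrow> F1 (w1 z) = F z" "\<And>z. 0 < Im z \<Longrightarrow> F2 (w2 z) = F z"
    "\<And>z. 0 < Im z \<Longrightarrow> w1 z + w2 z = z + F z"
proof -
  obtain v1 v2 where v: "\<And>w. w \<in> D \<Longrightarrow> 0 < Im (v1 w) \<and> 0 < Im (v2 w) \<and> F1 (v1 w) = F w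
      \<and> F2 (v2 w) = F w \<and> v1 w + v2 w = w + F w"
    using inv by metis
  define T1 where "T1 w v = w + (F1 v - v)" for w v
  define T where "T w v = w + (F2 (T1 w v) - T1 w v)" for w v
  have ImT1: "Im w \<le> Im (T1 w v)" if "0 < Im v" for w v
    using F1(2)[OF that] by (simp add: T1_def)
  have ImT: "Im w \<le> Im (T w v)" if "0 < Im v" "0 < Im w" for w v
    using F2(2)[of "T1 w v"] ImT1[OF that(1), of w] that by (simp add: T_def)
  define f where "f n w = (T w ^^ n) \<i>" for n w
  have f: "f n holomorphic_on \<H> \<and> (\<forall>w\<in>\<H>. 0 < Im (f n w))" for n
  proof (induction n)
    case 0 then show ?case by (simp add: f_def)
  next
    case (Suc n)
    have eq: "f (Suc n) w = w + (F2 (T1 w (f n w)) - T1 w (f n w))" for w by (simp add: f_def T_def)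
    have "(\<lambda>w. F1 (f n w)) holomorphic_on \<H>"
      using holomorphic_on_compose_gen[OF _ F1(1), of "f n" \<H>] Suc by (force simp: o_def)
    then have T1h: "(\<lambda>w. T1 w (f n w)) holomorphic_on \<H>"
      unfolding T1_def using Suc by (intro holomorphic_intros) auto
    have "0 < Im (T1 w (f n w))" if "w \<in> \<H>" for w
      using ImT1[of "f n w" w] Suc that by auto
    then have "(\<lambda>w. F2 (T1 w (f n w))) holomorphic_on \<H>"
      using holomorphic_on_compose_gen[OF T1h F2(1)] by (force simp: o_def)
    then have "f (Suc n) holomorphic_on \<H>"
      unfolding eq[abs_def] using T1h by (intro holomorphic_intros) auto
    moreover have "0 < Im (f (Suc n) w)" if "w \<in> \<H>" for w
      using ImT[of "f n w" w] Suc that by (force simp: f_def)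
    ultimately show ?case by blast
  qed
  \<comment> \<open>the Cayley transform makes the iterates uniformly bounded, as Montel's theorem requires\<close>
  define g where "g n w = (f n w - \<i>) / (f n w - cnj \<i>)" for n w
  have less: "cmod (f n w - \<i>) < cmod (f n w - cnj \<i>)" if "w \<in> \<H>" for n w
    using f[of n] that by (intro cmod_diff_less_cnj) auto
  have nz: "f n w - cnj \<i> \<noteq> 0" if "w \<in> \<H>" for n w using less[OF that, of n] by auto
  have g1: "cmod (g n w) \<le> 1" if "w \<in> \<H>" for n w
    using less[OF that, of n] nz[OF that] by (simp add: g_def norm_divide divide_le_eq_1)
  have holg: "g n holomorphic_on \<H>" for n
    unfolding g_def[abs_def] using nz f by (intro holomorphic_intros) auto
  obtain G r where G: "G holomorphic_on \<H>" "strict_mono (r :: nat \<Rightarrow> nat)"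
    and lim: "\<And>w. w \<in> \<H> \<Longrightarrow> (\<lambda>n. g (r n) w) \<longlonglongrightarrow> G w"
  proof (rule Montel[OF open_uhp, of "range g" g])
    fix K :: "complex set" assume "K \<subseteq> \<H>"
    then show "\<exists>B. \<forall>h\<in>range g. \<forall>z\<in>K. cmod (h z) \<le> B" using g1 by blast
  qed (use holg in auto)
  \<comment> \<open>On \<open>D\<close> the whole sequence of iterates converges to
    \<open>v1\<close>, so the subsequential limit \<open>G\<close> is the Cayley transform of
    \<open>v1\<close> there.\<close>
  have GD: "G w = (v1 w - \<i>) / (v1 w + \<i>)" if w: "w \<in> D" for w
  proof -
    have Iw: "0 < Im w" using w D by auto
    have "T1 w (v1 w) = v2 w" using v[OF w] by (simp add: T1_def algebra_simps)
    then have fixp: "T w (v1 w) = v1 w" using v[OF w] by (simp add: T_def algebra_simps)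
    have T1h: "T1 w holomorphic_on \<H>" unfolding T1_def[abs_def] using F1(1) by (intro holomorphic_intros) auto
    have "0 < Im (T1 w v)" if "0 < Im v" for v using ImT1[OF that, of w] Iw by simp
    then have "(\<lambda>v. F2 (T1 w v)) holomorphic_on \<H>"
      using holomorphic_on_compose_gen[OF T1h F2(1)] by (force simp: o_def)
    then have "T w holomorphic_on \<H>"
      unfolding T_def[abs_def] using T1h by (intro holomorphic_intros) auto
    then have "(\<lambda>n. (T w ^^ n) \<i>) \<longlonglongrightarrow> v1 w"
      using Iw ImT fixp v[OF w] by (intro funpow_uhp_tendsto_fixpoint[of _ "Im w"]) auto
    then have "(\<lambda>n. f n w) \<longlonglongrightarrow> v1 w" by (simp add: f_def)
    then have "(\<lambda>n. f (r n) w) \<longlonglongrightarrow> v1 w" using LIMSEQ_subseq_LIMSEQ[OF _ G(2)] by (fastforce simp: o_def)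
    moreover have "v1 w - cnj \<i> \<noteq> 0" using v[OF w] by (auto simp: complex_eq_iff)
    ultimately have "(\<lambda>n. g (r n) w) \<longlonglongrightarrow> (v1 w - \<i>) / (v1 w - cnj \<i>)"
      unfolding g_def by (intro tendsto_intros) auto
    then have "G w = (v1 w - \<i>) / (v1 w - cnj \<i>)"
      using LIMSEQ_unique[OF lim[of w]] Iw by simp
    then show ?thesis by simp
  qed
  have Gle: "cmod (G w) \<le> 1" if "w \<in> \<H>" for w
    using tendsto_norm[OF lim[OF that]] g1[OF that] by (intro LIMSEQ_le_const2) auto
  \<comment> \<open>If |G| were 1 at one point, the maximum principle would make it 1 everywhere,
    although |G| < 1 on \<open>D\<close>. Hence the inverse Cayley transform of \<open>G\<close> is
    finite and stays in the half-plane.\<close>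
  have Gless: "cmod (G w) < 1" if w: "w \<in> \<H>" for w
  proof (rule ccontr)
    assume "\<not> cmod (G w) < 1"
    then have "cmod (G w) = 1" using Gle[OF w] by simp
    then have "G constant_on \<H>"
      using maximum_modulus_principle[OF G(1) open_uhp connected_uhp open_uhp order_refl w] Gle by auto
    moreover obtain z where z: "z \<in> D" using D by blast
    ultimately have "cmod (G z) = 1"
      using \<open>cmod (G w) = 1\<close> w D(3) unfolding constant_on_def by auto
    moreover have "cmod (v1 z - \<i>) < cmod (v1 z - cnj \<i>)"
      using v[OF z] by (intro cmod_diff_less_cnj) auto
    ultimately show False using GD[OF z] by (auto simp: norm_divide divide_eq_1_iff)
  qed
  then have G1: "1 - G w \<noteq> 0" if "w \<in> \<H>" for w using that by fastforce
  \<comment> \<open>\<open>w1\<close> undoes the Cayley transform; \<open>w2\<close> is chosen so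
    that w1 + w2 = z + F becomes equivalent to F1(w1) = F.\<close>
  define w1 where "w1 w = \<i> * (1 + G w) / (1 - G w)" for w
  define w2 where "w2 w = w + F1 (w1 w) - w1 w" for w
  have w1D: "w1 w = v1 w" if w: "w \<in> D" for w
  proof -
    have nz: "v1 w + \<i> \<noteq> 0" using v[OF w] by (auto simp: complex_eq_iff)
    then have "1 - G w = 2 * \<i> / (v1 w + \<i>)" "1 + G w = 2 * v1 w / (v1 w + \<i>)"
      unfolding GD[OF w] by (simp_all add: field_simps)
    then show ?thesis using nz by (simp add: w1_def)
  qed
  have Imw1: "0 < Im (w1 w)" if w: "w \<in> \<H>" for w
  proof -
    have "Im (w1 w) = (1 - (cmod (G w))\<^sup>2) / (cmod (1 - G w))\<^sup>2"
      unfolding w1_def Im_divide cmod_power2 by (simp add: algebra_simps power2_eq_square)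
    moreover have "(cmod (G w))\<^sup>2 < 1" using Gless[OF w] by (simp add: abs_square_less_1)
    ultimately show ?thesis using G1[OF w] by simp
  qed
  have holw1: "w1 holomorphic_on \<H>"
    unfolding w1_def[abs_def] using G(1) G1 by (intro holomorphic_intros) auto
  have holF1w1: "(\<lambda>w. F1 (w1 w)) holomorphic_on \<H>"
    using holomorphic_on_compose_gen[OF holw1 F1(1)] Imw1 by (force simp: o_def)
  have holw2: "w2 holomorphic_on \<H>"
    unfolding w2_def[abs_def] using holw1 holF1w1 by (intro holomorphic_intros) auto
  have Imw2: "Im w \<le> Im (w2 w)" if "0 < Im w" for w
    using F1(2)[OF Imw1] that by (simp add: w2_def)
  have holF2w2: "(\<lambda>w. F2 (w2 w)) holomorphic_on \<H>"
    using holomorphic_on_compose_gen[OF holw2 F2(1)] Imw2 by (force simp: o_def)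
  have eq1: "F1 (w1 w) = F w" if "0 < Im w" for w
    by (rule analytic_continuation_open[OF D(1) open_uhp D(2) connected_uhp D(3) holF1w1 F])
      (use w1D v that in auto)
  have w2D: "w2 w = v2 w" if w: "w \<in> D" for w
    using v[OF w] by (simp add: w2_def w1D[OF w] algebra_simps)
  have eq2: "F2 (w2 w) = F w" if "0 < Im w" for w
    by (rule analytic_continuation_open[OF D(1) open_uhp D(2) connected_uhp D(3) holF2w2 F])
      (use w2D v that in auto)
  show thesis
  proof (rule that[OF holw1 holw2 _ Imw2 eq1 eq2])
    show sum: "w1 z + w2 z = z + F z" if "0 < Im z" for z
      using eq1[OF that] by (simp add: w2_def)
    \<comment> \<open>The lower bound for \<open>w1\<close> comes from the other summand: w1 - z =
      F2(w2) - w2.\<close>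
    show "Im z \<le> Im (w1 z)" if "0 < Im z" for z
    proof -
      have "0 < Im (w2 z)" using Imw2[OF that] that by simp
      moreover have "w1 z = z + F2 (w2 z) - w2 z" using sum[OF that] eq2[OF that] by (simp add: algebra_simps)
      ultimately show ?thesis using F2(2)[of "w2 z"] by simp
    qed
  qed
qed

section \<open>From Voiculescu transforms to subordination functions\<close>

lemma Gamma_cone_Im: "z \<in> Gamma_cone \<alpha> \<beta> \<Longrightarrow> 0 < \<beta> \<Longrightarrow> 0 < Im z"
  by (simp add: Gamma_cone_def)

lemma open_Gamma_cone: "open (Gamma_cone \<alpha> \<beta>)"
  unfolding Gamma_cone_def by (intro open_Collect_conj open_Collect_less continuous_intros)

lemma Gamma_cone_nonempty: "0 < \<alpha> \<Longrightarrow> 0 < \<beta> \<Longrightarrow> Gamma_cone \<alpha> \<beta> \<noteq> {}"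
proof -
  assume "0 < \<alpha>" "0 < \<beta>"
  then have "\<i> * of_real (\<beta> + 1) \<in> Gamma_cone \<alpha> \<beta>" by (simp add: Gamma_cone_def)
  then show ?thesis by blast
qed

text \<open>Additivity of the Voiculescu transforms at \<zeta> = F(w) reads w - \<zeta> = (v1 -
  \<zeta>) + (v2 - \<zeta>), where v1 and v2 are preimages of \<zeta>. This solves the system on an
  open set, and \<open>uhp_subordination\<close> continues the solution to the half-plane.\<close>

lemma free_add_conv_subordination:
  assumes M: "real_distribution M" "real_distribution M1" "real_distribution M2"
    and conv: "free_add_conv_of M M1 M2"
  obtains w1 w2 where "w1 holomorphic_on \<H>" "w2 holomorphic_on \<H>"
    "\<And>z. 0 < Im z \<Longrightarrow> Im z \<le> Im (w1 z)" "\<And>z. 0 < Im z \<Longrightarrow> Im z \<le> Im (w2 z)"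
    "\<And>z. 0 < Im z \<Longrightarrow> F_transform M1 (w1 z) = F_transform M z"
    "\<And>z. 0 < Im z \<Longrightarrow> F_transform M2 (w2 z) = F_transform M z"
    "\<And>z. 0 < Im z \<Longrightarrow> w1 z + w2 z = z + F_transform M z"
proof -
  obtain \<alpha> \<beta> a b a1 b1 a2 b2 where ab: "\<alpha> > 0" "\<beta> > 0"
    and V: "voiculescu_on M \<alpha> \<beta> a b" and V1: "voiculescu_on M1 \<alpha> \<beta> a1 b1" and V2: "voiculescu_on M2 \<alpha> \<beta> a2 b2"
    and eq: "\<And>z. z \<in> Gamma_cone \<alpha> \<beta> \<Longrightarrow> voiculescu M a b z = voiculescu M1 a1 b1 z + voiculescu M2 a2 b2 z"
    using conv unfolding free_add_conv_of_def by blast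
  have hol: "F_transform M holomorphic_on \<H>" using M(1) by (rule real_distribution.F_transform_holomorphic)
  \<comment> \<open>For w in \<open>D\<close> the value F(w) lies in the common cone, where all
    three inverses are available, and the inverse for \<open>M\<close> returns w itself.\<close>
  define D where "D = Gamma_cone a b \<inter> F_transform M -` Gamma_cone \<alpha> \<beta>"
  have sub: "Gamma_cone a b \<subseteq> \<H>" using V Gamma_cone_Im by (auto simp: voiculescu_on_def)
  have D1: "open D"
    unfolding D_def
    by (intro continuous_open_preimage open_Gamma_cone
        continuous_on_subset[OF holomorphic_on_imp_continuous_on[OF hol] sub])
  have D2: "D \<noteq> {}"
    using V Gamma_cone_nonempty[OF ab] by (fastforce simp: D_def voiculescu_on_def)
  have D3: "D \<subseteq> \<H>" using sub by (auto simp: D_def)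
  have inv: "\<exists>v1 v2. 0 < Im v1 \<and> 0 < Im v2 \<and> F_transform M1 v1 = F_transform M w
      \<and> F_transform M2 v2 = F_transform M w \<and> v1 + v2 = w + F_transform M w" if w: "w \<in> D" for w
  proof -
    define \<zeta> where "\<zeta> = F_transform M w"
    have \<zeta>: "\<zeta> \<in> Gamma_cone \<alpha> \<beta>" and wc: "w \<in> Gamma_cone a b" using w by (auto simp: D_def \<zeta>_def)
    have inv0: "inv_into (Gamma_cone a b) (F_transform M) \<zeta> = w"
      using V wc by (auto simp: \<zeta>_def voiculescu_on_def inv_into_f_f)
    have z1: "\<zeta> \<in> F_transform M1 ` Gamma_cone a1 b1" and z2: "\<zeta> \<in> F_transform M2 ` Gamma_cone a2 b2"
      using V1 V2 \<zeta> by (auto simp: voiculescu_on_def)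
    define v1 where "v1 = inv_into (Gamma_cone a1 b1) (F_transform M1) \<zeta>"
    define v2 where "v2 = inv_into (Gamma_cone a2 b2) (F_transform M2) \<zeta>"
    have "0 < b1" "0 < b2" using V1 V2 by (auto simp: voiculescu_on_def)
    then have "0 < Im v1" "0 < Im v2"
      unfolding v1_def v2_def using inv_into_into[OF z1] inv_into_into[OF z2] Gamma_cone_Im by blast+
    moreover have "F_transform M1 v1 = \<zeta>" "F_transform M2 v2 = \<zeta>"
      unfolding v1_def v2_def using f_inv_into_f[OF z1] f_inv_into_f[OF z2] by auto
    moreover have "w - \<zeta> = (v1 - \<zeta>) + (v2 - \<zeta>)"
      using eq[OF \<zeta>] unfolding voiculescu_def inv0 v1_def v2_def .
    then have "v1 + v2 = w + \<zeta>" by (simp add: algebra_simps)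
    ultimately show ?thesis unfolding \<zeta>_def by blast
  qed
  show thesis
    by (rule uhp_subordination[OF hol real_distribution.F_transform_holomorphic[OF M(2)]
          real_distribution.Im_F_transform_ge[OF M(2)] real_distribution.F_transform_holomorphic[OF M(3)]
          real_distribution.Im_F_transform_ge[OF M(3)]
          D1 D2 D3 inv], assumption+, rule that)
qed

section \<open>Supports and boundary behaviour\<close>

lemma closed_supp: "closed (supp M)"
  unfolding supp_def by (rule closed_Compl) auto

lemma compact_supp_bounds:
  assumes "compact (supp M)" "supp M \<noteq> {}"
  obtains a b where "a \<in> supp M" "b \<in> supp M" "supp M \<subseteq> {a..b}"
proof -
  obtain a where "a \<in> supp M" "\<And>t. t \<in> supp M \<Longrightarrow> a \<le> t"
    using compact_attains_inf[OF assms] by blast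
  moreover obtain b where "b \<in> supp M" "\<And>t. t \<in> supp M \<Longrightarrow> t \<le> b"
    using compact_attains_sup[OF assms] by blast
  ultimately show thesis by (intro that[of a b]) auto
qed

lemma diam_le:
  assumes "\<And>s t. s \<in> S \<Longrightarrow> t \<in> S \<Longrightarrow> s - t \<le> d"
  shows "diam S \<le> ereal d"
  unfolding diam_def
proof (rule SUP_least)
  fix p assume "p \<in> S \<times> S"
  then show "ereal (dist (fst p) (snd p)) \<le> ereal d"
    using assms[of "fst p" "snd p"] assms[of "snd p" "fst p"] by (auto simp: dist_real_def abs_if)
qed

lemma diam_eq:
  assumes "a \<in> S" "b \<in> S" "S \<subseteq> {a..b}"
  shows "diam S = ereal (b - a)"
proof (rule antisym)
  show "diam S \<le> ereal (b - a)"
  proof (rule diam_le)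
    fix s t assume "s \<in> S" "t \<in> S"
    then have "s \<le> b" "a \<le> t" using assms(3) by auto
    then show "s - t \<le> b - a" by simp
  qed
  have "a \<le> b" using assms by auto
  then have "ereal (b - a) = ereal (dist (fst (a, b)) (snd (a, b)))" by (simp add: dist_real_def)
  also have "\<dots> \<le> diam S" unfolding diam_def by (rule SUP_upper) (use assms in auto)
  finally show "ereal (b - a) \<le> diam S" .
qed

section \<open>The support of a real distribution and Stieltjes inversion\<close>

context real_distribution
begin

text \<open>By the Lindelof property the union of all open null sets is already a countable union of
  them, hence null.\<close>

lemma AE_supp: "AE t in M. t \<in> supp M"
proof -
  let ?F = "{U. open U \<and> emeasure M U = 0}"
  obtain F' where F': "F' \<subseteq> ?F" "countable F'" "\<Union>F' = \<Union>?F"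
    by (rule Lindelof[of ?F]) auto
  have "(\<Union>U\<in>F'. U) \<in> null_sets M"
    using F' by (intro null_sets_UN') (auto simp: null_sets_def subset_eq)
  moreover have "{t \<in> space M. t \<notin> supp M} \<subseteq> (\<Union>U\<in>F'. U)"
    using F'(3) by (auto simp: supp_def)
  ultimately show ?thesis by (rule AE_I')
qed

lemma supp_nonempty: "supp M \<noteq> {}"
  using AE_supp by auto

lemma cdf_diff_le:
  assumes "x < y"
  shows "cdf M y - cdf M x \<le> - 2 * (y - x) * Im (cauchy_transform M (Complex x (y - x)))"
proof -
  define z where "z = Complex x (y - x)"
  have z: "z \<in> off_real UNIV" using assms by (auto simp: off_real_def z_def)
  define N where "N = (\<integral>t. (cmod (1 / (z - complex_of_real t)))\<^sup>2 \<partial>M)"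
  \<comment> \<open>the Poisson kernel of height \<open>y - x\<close> at \<open>x\<close> is at least \<open>1 / (2 (y - x))\<close> on \<open>{x<..y}\<close>\<close>
  have "cdf M y - cdf M x = measure M {x<..y}" using assms by (rule cdf_diff_eq)
  also have "\<dots> = 2 * (y - x)\<^sup>2 * (\<integral>t. 1 / (2 * (y - x)\<^sup>2) * indicator {x<..y} t \<partial>M)"
    using assms by simp
  also have "\<dots> \<le> 2 * (y - x)\<^sup>2 * N"
    unfolding N_def
  proof (intro mult_left_mono integral_mono)
    show "integrable M (\<lambda>t. (cmod (1 / (z - complex_of_real t)))\<^sup>2)"
      using integrable_resolvent_powers(3)[OF _ _ z] by auto
    show "integrable M (\<lambda>t. 1 / (2 * (y - x)\<^sup>2) * indicator {x<..y} t)"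
      by (intro integrable_mult_right integrable_real_indicator) (auto simp: emeasure_eq_measure)
    fix t :: real
    show "1 / (2 * (y - x)\<^sup>2) * indicator {x<..y} t \<le> (cmod (1 / (z - complex_of_real t)))\<^sup>2"
    proof (cases "t \<in> {x<..y}")
      case True
      then have "(x - t)\<^sup>2 \<le> (y - x)\<^sup>2" by (intro power2_le_iff_abs_le[THEN iffD2]) auto
      moreover have "(cmod (z - of_real t))\<^sup>2 = (x - t)\<^sup>2 + (y - x)\<^sup>2" by (simp add: z_def cmod_power2)
      ultimately have "(cmod (z - of_real t))\<^sup>2 \<le> 2 * (y - x)\<^sup>2" "0 < (cmod (z - of_real t))\<^sup>2"
        using assms by (auto simp: add_nonneg_pos)
      then show ?thesis using True by (simp add: norm_divide power_divide frac_le)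
    qed simp
  qed simp
  also have "\<dots> = - 2 * (y - x) * Im (cauchy_transform M z)"
    using Im_cauchy_transform[OF _ _ z] by (simp add: N_def[symmetric]) (simp add: z_def power2_eq_square algebra_simps)
  finally show ?thesis by (simp add: z_def)
qed

text \<open>\<open>cdf_diff_le\<close> turns the bound linear in \<epsilon> into a quadratic bound
  on increments of the distribution function. So its derivative vanishes near \<open>s0\<close>, and
  a whole interval about \<open>s0\<close> is null.\<close>

lemma not_in_supp_if_Im_cauchy_transform_le:
  assumes \<delta>: "0 < \<delta>"
    and C: "\<And>s \<epsilon>. \<bar>s - s0\<bar> < \<delta> \<Longrightarrow> 0 < \<epsilon> \<Longrightarrow> \<epsilon> < \<delta> \<Longrightarrow> - Im (cauchy_transform M (Complex s \<epsilon>)) \<le> C * \<epsilon>"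
  shows "s0 \<notin> supp M"
proof -
  \<comment> \<open>Halving the radius keeps y - x, the height at which the Cauchy transform is
    evaluated, below \<open>\<delta>\<close>.\<close>
  define J where "J = {s0 - \<delta>/2 <..< s0 + \<delta>/2}"
  have quad: "\<bar>cdf M y - cdf M x\<bar> \<le> 2 * C * (y - x)\<^sup>2" if "x \<in> J" "y \<in> J" for x y
  proof -
    have *: "\<bar>cdf M y - cdf M x\<bar> \<le> 2 * C * (y - x)\<^sup>2" if "x \<in> J" "y \<in> J" "x < y" for x y
    proof -
      have "0 \<le> cdf M y - cdf M x" using cdf_nondecreasing[of x y] that by simp
      moreover have "- Im (cauchy_transform M (Complex x (y - x))) \<le> C * (y - x)"
        using that \<delta> by (intro C) (auto simp: J_def abs_if)
      then have "2 * (y - x) * - Im (cauchy_transform M (Complex x (y - x))) \<le> 2 * (y - x) * (C * (y - x))"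
        using that by (intro mult_left_mono) auto
      ultimately show ?thesis using cdf_diff_le[OF that(3)] by (simp add: power2_eq_square algebra_simps)
    qed
    consider "x < y" | "y < x" | "x = y" by linarith
    then show ?thesis
    proof cases
      case 2
      then show ?thesis using *[OF that(2,1)] by (simp add: abs_minus_commute power2_commute)
    qed (use * that in auto)
  qed
  have deriv: "(cdf M has_field_derivative 0) (at x)" if x: "x \<in> J" for x
    unfolding has_field_derivative_iff
  proof (rule Lim_null_comparison)
    have "\<forall>\<^sub>F y in at x. y \<in> J"
      using x eventually_at_topological by (metis J_def open_greaterThanLessThan)
    then show "\<forall>\<^sub>F y in at x. norm ((cdf M y - cdf M x) / (y - x)) \<le> 2 * C * \<bar>y - x\<bar>"
    proof eventually_elim
      case (elim y)
      have "norm ((cdf M y - cdf M x) / (y - x)) = \<bar>cdf M y - cdf M x\<bar> / \<bar>y - x\<bar>" by simp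
      also have "\<dots> \<le> (2 * C * (y - x)\<^sup>2) / \<bar>y - x\<bar>" using quad[OF x elim] by (intro divide_right_mono) auto
      also have "(y - x)\<^sup>2 = \<bar>y - x\<bar> * \<bar>y - x\<bar>" by (simp add: power2_eq_square)
      also have "2 * C * (\<bar>y - x\<bar> * \<bar>y - x\<bar>) / \<bar>y - x\<bar> = 2 * C * \<bar>y - x\<bar>"
        by (simp del: abs_mult_self_eq)
      finally show ?case .
    qed
    show "((\<lambda>y. 2 * C * \<bar>y - x\<bar>) \<longlongrightarrow> 0) (at x)" by (auto intro!: tendsto_eq_intros)
  qed
  have const: "cdf M x = cdf M y" if "x \<in> J" "y \<in> J" for x y
    using DERIV_isconst3[of "s0 - \<delta>/2" "s0 + \<delta>/2" x y "cdf M"] deriv that \<delta> by (auto simp: J_def)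
  have "measure M {s0 - \<delta>/4 <.. s0 + \<delta>/4} = 0"
    using cdf_diff_eq[of "s0 - \<delta>/4" "s0 + \<delta>/4"] const[of "s0 - \<delta>/4" "s0 + \<delta>/4"] \<delta> by (simp add: J_def)
  then have "measure M {s0 - \<delta>/4 <..< s0 + \<delta>/4} = 0"
    using finite_measure_mono[of "{s0 - \<delta>/4 <..< s0 + \<delta>/4}" "{s0 - \<delta>/4 <.. s0 + \<delta>/4}"]
      measure_nonneg[of M "{s0 - \<delta>/4 <..< s0 + \<delta>/4}"] by (simp add: subset_eq)
  then have "emeasure M {s0 - \<delta>/4 <..< s0 + \<delta>/4} = 0" by (simp add: emeasure_eq_measure)
  then show ?thesis using \<delta> by (auto simp: supp_def intro!: exI[of _ "{s0 - \<delta>/4 <..< s0 + \<delta>/4}"])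
qed

section \<open>Measures carried by a compact interval\<close>

context
  fixes a b :: real
  assumes ab: "AE t in M. t \<in> {a..b}"
begin

text \<open>The integrand 1 / (x - t) has constant sign on \<open>{a..b}\<close>; the factor
  \<open>s\<close> makes it positive.\<close>

lemma cauchy_transform_real_nonzero:
  assumes x: "x \<notin> {a..b}"
  shows "cauchy_transform M (of_real x) \<noteq> 0"
proof -
  define s :: real where "s = (if x < a then -1 else 1)"
  have z: "complex_of_real x \<in> off_real {a..b}" using x by (simp add: off_real_def)
  have int: "integrable M (\<lambda>t. 1 / (complex_of_real x - complex_of_real t))"
    using integrable_resolvent_powers(1)[OF _ ab z] by simp
  then have ints: "integrable M (\<lambda>t. s * Re (1 / (complex_of_real x - complex_of_real t)))"
    by (intro integrable_mult_right integrable_Re)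
  have "0 < (\<integral>t. s * Re (1 / (complex_of_real x - complex_of_real t)) \<partial>M)"
  proof (rule integral_less_AE_space[of "\<lambda>_. 0", simplified])
    show "integrable M (\<lambda>t. s * Re (1 / (complex_of_real x - complex_of_real t)))" by fact
    have re: "Re (1 / (complex_of_real x - complex_of_real t)) = 1 / (x - t)" for t
      by (metis Re_complex_of_real of_real_1 of_real_diff of_real_divide)
    show "AE t in M. 0 < s * Re (1 / (complex_of_real x - complex_of_real t))"
      using ab unfolding re by eventually_elim (use x in \<open>auto simp: s_def zero_less_mult_iff divide_less_0_iff\<close>)
    show "emeasure M UNIV \<noteq> 0" using emeasure_space_1 by simp
  qed
  also have "\<dots> = s * Re (cauchy_transform M (of_real x))"
    unfolding cauchy_transform_def by (simp only: integral_mult_right_zero integral_Re[OF int])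
  finally show ?thesis by auto
qed

text \<open>Near \<open>x\<close> the mean of 1 / |z - t|^2 is at most 1 / d^2, and |G| is at least
  half of |G(x)|, which is positive. The two bounds feed the reflection argument and the support
  criterion respectively.\<close>

lemma transforms_Im_le_near_real:
  assumes x: "x \<notin> {a..b}"
  obtains \<delta> C where "0 < \<delta>" "0 \<le> C"
    "\<And>z. z \<in> ball (of_real x) \<delta> \<Longrightarrow> 0 < Im z \<Longrightarrow> Im (F_transform M z) \<le> C * Im z"
    "\<And>z. z \<in> ball (of_real x) \<delta> \<Longrightarrow> 0 < Im z \<Longrightarrow> - Im (cauchy_transform M z) \<le> C * Im z"
proof -
  have z: "complex_of_real x \<in> off_real {a..b}" using x by (simp add: off_real_def)
  obtain d where d: "0 < d" "\<And>w. w \<in> ball (of_real x) d \<Longrightarrow> AE t in M. d \<le> cmod (w - of_real t)"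
    using AE_resolvent_gap[OF _ ab z] by auto
  have N: "(\<integral>t. (cmod (1 / (w - complex_of_real t)))\<^sup>2 \<partial>M) \<le> 1 / d\<^sup>2" if "w \<in> ball (of_real x) d" "0 < Im w" for w
  proof -
    have w: "w \<in> off_real {a..b}" using that by (auto simp: off_real_def)
    have "(\<integral>t. (cmod (1 / (w - complex_of_real t)))\<^sup>2 \<partial>M) \<le> (\<integral>t. 1 / d\<^sup>2 \<partial>M)"
    proof (rule integral_mono_AE)
      show "integrable M (\<lambda>t. (cmod (1 / (w - complex_of_real t)))\<^sup>2)"
        using integrable_resolvent_powers(3)[OF _ ab w] by simp
      show "AE t in M. (cmod (1 / (w - complex_of_real t)))\<^sup>2 \<le> 1 / d\<^sup>2"
        using d(2)[OF that(1)]
        by eventually_elim (use d(1) in \<open>auto simp: norm_divide power_divide intro!: divide_left_mono power_mono mult_pos_pos zero_less_power\<close>)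
    qed simp
    then show ?thesis using prob_space by simp
  qed
  define c where "c = cmod (cauchy_transform M (of_real x)) / 2"
  have c: "0 < c" using cauchy_transform_real_nonzero[OF x] by (simp add: c_def)
  have "isCont (cauchy_transform M) (of_real x)"
    using cauchy_transform_has_derivative[OF _ ab z] DERIV_isCont by auto
  then obtain e where e: "0 < e" "\<And>w. dist w (of_real x) < e \<Longrightarrow>
      dist (cauchy_transform M w) (cauchy_transform M (of_real x)) < c"
    using c unfolding continuous_at_eps_delta by blast
  have G: "c \<le> cmod (cauchy_transform M w)" if "w \<in> ball (of_real x) e" for w
  proof -
    have "cmod (cauchy_transform M w - cauchy_transform M (of_real x)) < c"
      using e(2)[of w] that by (simp add: dist_norm norm_minus_commute)
    moreover have "cmod (cauchy_transform M (of_real x)) \<le> cmod (cauchy_transform M w)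
        + cmod (cauchy_transform M w - cauchy_transform M (of_real x))"
      by (metis norm_minus_commute norm_triangle_sub)
    ultimately show ?thesis by (simp add: c_def)
  qed
  show thesis
  proof (rule that[of "min d e" "max (1 / d\<^sup>2) (1 / d\<^sup>2 / c\<^sup>2)"])
    fix w assume w: "w \<in> ball (complex_of_real x) (min d e)" "0 < Im w"
    have "c\<^sup>2 \<le> (cmod (cauchy_transform M w))\<^sup>2" using G[of w] w c by (intro power_mono) auto
    then have "(\<integral>t. (cmod (1 / (w - complex_of_real t)))\<^sup>2 \<partial>M) / (cmod (cauchy_transform M w))\<^sup>2 \<le> 1 / d\<^sup>2 / c\<^sup>2"
      using N[of w] w c by (intro frac_le) auto
    then have "Im w * ((\<integral>t. (cmod (1 / (w - complex_of_real t)))\<^sup>2 \<partial>M) / (cmod (cauchy_transform M w))\<^sup>2)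
        \<le> Im w * max (1 / d\<^sup>2) (1 / d\<^sup>2 / c\<^sup>2)"
      using w by (intro mult_left_mono) auto
    then show "Im (F_transform M w) \<le> max (1 / d\<^sup>2) (1 / d\<^sup>2 / c\<^sup>2) * Im w"
      unfolding Im_F_transform[OF w(2)] by (simp add: mult.commute)
    have wz: "w \<in> off_real {a..b}" using w by (auto simp: off_real_def)
    have "Im w * (\<integral>t. (cmod (1 / (w - complex_of_real t)))\<^sup>2 \<partial>M) \<le> Im w * max (1 / d\<^sup>2) (1 / d\<^sup>2 / c\<^sup>2)"
      using w N[of w] by (intro mult_left_mono) auto
    then show "- Im (cauchy_transform M w) \<le> max (1 / d\<^sup>2) (1 / d\<^sup>2 / c\<^sup>2) * Im w"
      using Im_cauchy_transform[OF _ ab wz] by (simp add: mult.commute)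
  qed (use d e in \<open>auto simp: le_max_iff_disj\<close>)
qed

text \<open>Im (F(z) - z) / Im z is the variance of 1 / (z - t) divided by |G|^2. The variance is at
  most the mean square distance to 1 / z, which is of order |z|^-4, while |G|^2 is at least of order
  |z|^-2.\<close>

lemma Im_F_transform_minus_le_at_infinity:
  obtains R c where "0 < R" "0 < c"
    "\<And>z. R \<le> cmod z \<Longrightarrow> 0 < Im z \<Longrightarrow> Im (F_transform M z - z) \<le> c / (cmod z)\<^sup>2 * Im z"
proof -
  define m where "m = 1 + \<bar>a\<bar> + \<bar>b\<bar>"
  have m: "0 < m" by (simp add: m_def)
  have abm: "AE t in M. \<bar>t\<bar> \<le> m" using ab by eventually_elim (auto simp: m_def)
  show thesis
  \<comment> \<open>The radius \<open>4 * m\<close> ensures |z - t| >= |z| / 2 and |G - 1 / z| <= 1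
    / (2 |z|); the constant \<open>16 * m\<^sup>2\<close> is what remains of (2 m / r^2)^2 / (1 / (2
    r))^2.\<close>
  proof (rule that[of "4 * m" "16 * m\<^sup>2"])
    fix z assume zR: "4 * m \<le> cmod z" and Imz: "0 < Im z"
    have z: "z \<in> off_real {a..b}" using Imz by (auto simp: off_real_def)
    define r where "r = cmod z"
    have r: "4 * m \<le> r" "0 < r" using zR m by (auto simp: r_def)
    define N where "N = (\<integral>t. (cmod (1 / (z - complex_of_real t)))\<^sup>2 \<partial>M)"
    define G where "G = cauchy_transform M z"
    have int: "integrable M (\<lambda>t. (cmod (1 / (z - complex_of_real t) - 1 / z))\<^sup>2)"
    proof -
      have "(cmod (f - c))\<^sup>2 = (cmod f)\<^sup>2 - 2 * Re (cnj c * f) + (cmod c)\<^sup>2" for f c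
        unfolding cmod_power2 by (simp add: algebra_simps power2_eq_square)
      then have eq: "(\<lambda>t. (cmod (1 / (z - complex_of_real t) - 1 / z))\<^sup>2)
          = (\<lambda>t. (cmod (1 / (z - complex_of_real t)))\<^sup>2
          - 2 * Re (cnj (1 / z) * (1 / (z - complex_of_real t))) + (cmod (1 / z))\<^sup>2)" by metis
      have "integrable M (\<lambda>t. 1 / (z - complex_of_real t))"
        using integrable_resolvent_powers(1)[OF _ ab z] by simp
      then show ?thesis
        unfolding eq using integrable_resolvent_powers(3)[OF _ ab z]
        by (intro Bochner_Integration.integrable_add Bochner_Integration.integrable_diff
            integrable_mult_right integrable_Re) auto
    qed
    have var: "(\<integral>t. (cmod (1 / (z - complex_of_real t) - 1 / z))\<^sup>2 \<partial>M) = N - (cmod G)\<^sup>2 + (cmod (G - 1 / z))\<^sup>2"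
      unfolding N_def G_def using cauchy_transform_variance[OF _ ab z] by simp
    have "(\<integral>t. (cmod (1 / (z - complex_of_real t) - 1 / z))\<^sup>2 \<partial>M) \<le> (\<integral>t. (2 * m / r\<^sup>2)\<^sup>2 \<partial>M)"
    proof (rule integral_mono_AE[OF int])
      show "AE t in M. (cmod (1 / (z - complex_of_real t) - 1 / z))\<^sup>2 \<le> (2 * m / r\<^sup>2)\<^sup>2"
        using abm
      proof eventually_elim
        case (elim t)
        have "r \<le> cmod (z - of_real t) + \<bar>t\<bar>"
          unfolding r_def by (metis diff_add_cancel norm_of_real norm_triangle_ineq)
        then have h: "r / 2 \<le> cmod (z - of_real t)" using elim r m by linarith
        then have nz: "z - of_real t \<noteq> 0" "z \<noteq> 0" using r by (auto simp: r_def)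
        then have "1 / (z - complex_of_real t) - 1 / z = of_real t / ((z - of_real t) * z)"
          by (simp add: field_simps)
        then have "cmod (1 / (z - complex_of_real t) - 1 / z) = \<bar>t\<bar> / (cmod (z - of_real t) * r)"
          by (simp add: norm_divide norm_mult r_def)
        also have "\<dots> \<le> m / (r / 2 * r)"
          using elim h r m by (intro frac_le mult_mono) auto
        also have "\<dots> = 2 * m / r\<^sup>2" by (simp add: power2_eq_square)
        finally show ?case by (intro power_mono) auto
      qed
    qed simp
    also have "\<dots> = (2 * m / r\<^sup>2)\<^sup>2" using prob_space by simp
    finally have V: "N - (cmod G)\<^sup>2 + (cmod (G - 1 / z))\<^sup>2 \<le> (2 * m / r\<^sup>2)\<^sup>2" using var by simp
    have NG: "(cmod G)\<^sup>2 \<le> N" unfolding N_def G_def using norm_cauchy_transform_le[OF _ ab z] by simp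
    then have "(cmod (G - 1 / z))\<^sup>2 \<le> (2 * m / r\<^sup>2)\<^sup>2" using V by simp
    then have "cmod (G - 1 / z) \<le> 2 * m / r\<^sup>2" by (rule power2_le_imp_le) (use m in simp)
    also have "\<dots> \<le> 1 / (2 * r)" using r m by (simp add: field_simps power2_eq_square)
    finally have "cmod (G - 1 / z) \<le> 1 / (2 * r)" .
    moreover have "cmod (1 / z) \<le> cmod G + cmod (G - 1 / z)"
      by (metis norm_minus_commute norm_triangle_sub)
    moreover have "cmod (1 / z) = 1 / (2 * r) + 1 / (2 * r)" by (simp add: norm_divide r_def)
    ultimately have Gr: "1 / (2 * r) \<le> cmod G" by linarith
    have Gpos: "0 < cmod G" using Gr r by (meson divide_pos_pos less_le_trans mult_pos_pos zero_less_numeral zero_less_one)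
    have "Im (F_transform M z - z) = Im z * (N / (cmod G)\<^sup>2 - 1)"
      using Im_F_transform[OF Imz] by (simp add: N_def G_def algebra_simps)
    also have "N / (cmod G)\<^sup>2 - 1 = (N - (cmod G)\<^sup>2) / (cmod G)\<^sup>2" using Gpos by (simp add: field_simps)
    also have "Im z * \<dots> \<le> Im z * ((2 * m / r\<^sup>2)\<^sup>2 / (1 / (2 * r))\<^sup>2)"
    proof (intro mult_left_mono frac_le power_mono Gr)
      show "N - (cmod G)\<^sup>2 \<le> (2 * m / r\<^sup>2)\<^sup>2" using V by (smt (verit) zero_le_power2)
    qed (use Imz r in auto)
    also have "(2 * m / r\<^sup>2)\<^sup>2 / (1 / (2 * r))\<^sup>2 = 16 * m\<^sup>2 / r\<^sup>2"
      using r by (simp add: field_simps power2_eq_square)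
    finally show "Im (F_transform M z - z) \<le> 16 * m\<^sup>2 / (cmod z)\<^sup>2 * Im z"
      by (simp add: r_def mult.commute)
  qed (use m in auto)
qed

end

end

section \<open>Displacement of the support under subordination\<close>

text \<open>Join the two points by three sides of a rectangle with top at height \<open>R\<close>.
  Each side lies in a convex region where |z| >= R, so the derivative is at most c / R^2 there, and
  the total length is at most 4 R.\<close>

lemma opposite_ends_diff_le:
  assumes hol: "u holomorphic_on \<H>" and R: "0 < R" and c: "0 \<le> c"
    and d: "\<And>z. R \<le> cmod z \<Longrightarrow> 0 < Im z \<Longrightarrow> cmod (deriv u z) \<le> c / (cmod z)\<^sup>2"
    and \<epsilon>: "0 < \<epsilon>" "\<epsilon> \<le> R"
  shows "cmod (u (Complex R \<epsilon>) - u (Complex (- R) \<epsilon>)) \<le> 4 * c / R"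
proof -
  have lip: "cmod (u v - u w) \<le> c / R\<^sup>2 * cmod (v - w)"
    if A: "convex A" "A \<subseteq> \<H>" "\<And>z. z \<in> A \<Longrightarrow> R \<le> cmod z" and vw: "v \<in> A" "w \<in> A" for A v w
  proof (rule field_differentiable_bound[OF A(1) _ _ vw])
    fix z assume z: "z \<in> A"
    show "(u has_field_derivative deriv u z) (at z within A)"
      using holomorphic_derivI[OF hol open_uhp] z A(2) by (blast intro: has_field_derivative_at_within)
    have "cmod (deriv u z) \<le> c / (cmod z)\<^sup>2" using d[OF A(3)[OF z]] z A(2) by auto
    also have "\<dots> \<le> c / R\<^sup>2" using A(3)[OF z] R c by (intro frac_le power_mono) auto
    finally show "cmod (deriv u z) \<le> c / R\<^sup>2" .
  qed
  have 1: "cmod (u (Complex R \<epsilon>) - u (Complex R R)) \<le> c / R\<^sup>2 * cmod (Complex R \<epsilon> - Complex R R)"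
  proof (rule lip)
    show "convex (\<H> \<inter> {z. R \<le> Re z})" by (intro convex_Int convex_halfspace_Im_gt convex_halfspace_Re_ge)
    show "R \<le> cmod z" if "z \<in> \<H> \<inter> {z. R \<le> Re z}" for z using that complex_Re_le_cmod[of z] by simp
  qed (use \<epsilon> R in auto)
  have 2: "cmod (u (Complex R R) - u (Complex (-R) R)) \<le> c / R\<^sup>2 * cmod (Complex R R - Complex (-R) R)"
  proof (rule lip)
    show "convex {z. R \<le> Im z}" by (rule convex_halfspace_Im_ge)
    show "R \<le> cmod z" if "z \<in> {z. R \<le> Im z}" for z using that abs_Im_le_cmod[of z] by simp
  qed (use R in auto)
  have 3: "cmod (u (Complex (-R) R) - u (Complex (-R) \<epsilon>)) \<le> c / R\<^sup>2 * cmod (Complex (-R) R - Complex (-R) \<epsilon>)"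
  proof (rule lip)
    show "convex (\<H> \<inter> {z. Re z \<le> - R})" by (intro convex_Int convex_halfspace_Im_gt convex_halfspace_Re_le)
    show "R \<le> cmod z" if "z \<in> \<H> \<inter> {z. Re z \<le> - R}" for z using that abs_Re_le_cmod[of z] by auto
  qed (use \<epsilon> R in auto)
  have n: "cmod (Complex R \<epsilon> - Complex R R) \<le> R" "cmod (Complex R R - Complex (-R) R) = 2 * R"
    "cmod (Complex (-R) R - Complex (-R) \<epsilon>) \<le> R"
    using \<epsilon> R by (auto simp: cmod_def real_sqrt_mult)
  have "cmod (u (Complex R \<epsilon>) - u (Complex (-R) \<epsilon>)) \<le> cmod (u (Complex R \<epsilon>) - u (Complex R R))
      + cmod (u (Complex R R) - u (Complex (-R) R)) + cmod (u (Complex (-R) R) - u (Complex (-R) \<epsilon>))"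
    by (smt (verit) norm_triangle_sub diff_add_cancel add_diff_eq norm_triangle_ineq)
  also have "\<dots> \<le> c / R\<^sup>2 * R + c / R\<^sup>2 * (2 * R) + c / R\<^sup>2 * R"
    using n c
    by (intro add_mono order_trans[OF 1] order_trans[OF 2] order_trans[OF 3] mult_left_mono) auto
  also have "\<dots> = 4 * c / R" using R by (simp add: field_simps power2_eq_square)
  finally show ?thesis .
qed

text \<open>All that is kept of the second subordination function is \<open>Im_w1_le\<close>.
  Together with \<open>Im_w1_ge\<close> it squeezes Im (w1 z - z) between 0 and Im (F(z) -
  z).\<close>

locale subordinate_compact =
  M: real_distribution M + M1: real_distribution M1 for M M1 :: "real measure" +
  fixes a b :: real and w1 :: "complex \<Rightarrow> complex"
  assumes AE_M: "AE t in M. t \<in> {a..b}"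
    and hol_w1: "w1 holomorphic_on \<H>"
    and Im_w1_ge: "\<And>z. 0 < Im z \<Longrightarrow> Im z \<le> Im (w1 z)"
    and Im_w1_le: "\<And>z. 0 < Im z \<Longrightarrow> Im (w1 z) \<le> Im (F_transform M z)"
    and F_w1: "\<And>z. 0 < Im z \<Longrightarrow> F_transform M1 (w1 z) = F_transform M z"
begin

lemma open_S: "open (off_real {a..b})"
  by (rule open_off_real) simp

text \<open>Im (w1 z - z) is at most Im F(z), which is linear in Im z near real points off the
  interval; so the reflection lemma applies.\<close>

lemma displacement_extension:
  obtains U where "U holomorphic_on off_real {a..b}" "\<And>z. 0 < Im z \<Longrightarrow> U z = w1 z - z"
    "\<And>z. z \<in> off_real {a..b} \<Longrightarrow> U (cnj z) = cnj (U z)"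
proof (rule uhp_reflection_extension[of "off_real {a..b}" "\<lambda>z. w1 z - z"])
  fix x assume "complex_of_real x \<in> off_real {a..b}"
  then have "x \<notin> {a..b}" by (simp add: off_real_def)
  then obtain \<delta> C where \<delta>: "0 < \<delta>"
    and C: "\<And>z. z \<in> ball (of_real x) \<delta> \<Longrightarrow> 0 < Im z \<Longrightarrow> Im (F_transform M z) \<le> C * Im z"
    using M.transforms_Im_le_near_real[OF AE_M] by metis
  have "Im (w1 z - z) \<le> C * Im z" if "z \<in> ball (of_real x) \<delta> \<inter> \<H>" for z
    using C[of z] Im_w1_le[of z] that by auto
  then show "\<exists>\<delta>>0. \<exists>C. \<forall>z\<in>ball (of_real x) \<delta> \<inter> \<H>. Im (w1 z - z) \<le> C * Im z"
    using \<delta> by blast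
qed (use open_S uhp_subset_off_real Im_w1_ge hol_w1 in \<open>auto simp: off_real_def intro!: holomorphic_intros\<close>)

context
  fixes U
  assumes U: "U holomorphic_on off_real {a..b}" "\<And>z. 0 < Im z \<Longrightarrow> U z = w1 z - z"
    "\<And>z. z \<in> off_real {a..b} \<Longrightarrow> U (cnj z) = cnj (U z)"
begin

lemma U_real: "x \<notin> {a..b} \<Longrightarrow> Im (U (of_real x)) = 0"
  using U(3)[of "of_real x"] by (simp add: off_real_def complex_eq_iff)

lemma U_mono:
  assumes "x \<le> y" "y < a \<or> b < x"
  shows "Re (U (of_real x)) \<le> Re (U (of_real y))"
proof (rule Re_mono_on_reals[OF open_S U(1) _ assms(1)])
  show "0 \<le> Im (U z)" if "0 < Im z" for z using U(2) Im_w1_ge that by simp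
  show "complex_of_real t \<in> off_real {a..b} \<and> Im (U (of_real t)) = 0" if "x \<le> t" "t \<le> y" for t
    using that assms(2) U_real[of t] by (auto simp: off_real_def)
qed

lemma U_isCont: "x \<notin> {a..b} \<Longrightarrow> isCont U (of_real x)"
  using holomorphic_on_imp_continuous_on[OF U(1)] open_S
  by (auto simp: continuous_on_eq_continuous_at off_real_def)

text \<open>\<open>U\<close> increases along each half-line, so it is enough to compare the far
  points R and - R, where the values differ by at most 4 c / R.\<close>

lemma U_right_le_left:
  assumes "y < a" "b < x"
  shows "Re (U (of_real x)) \<le> Re (U (of_real y))"
proof -
  obtain R0 c where R0: "0 < R0" "0 < c"
    and F: "\<And>z. R0 \<le> cmod z \<Longrightarrow> 0 < Im z \<Longrightarrow> Im (F_transform M z - z) \<le> c / (cmod z)\<^sup>2 * Im z"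
    using M.Im_F_transform_minus_le_at_infinity[OF AE_M] by blast
  have holu: "(\<lambda>z. w1 z - z) holomorphic_on \<H>" using hol_w1 by (intro holomorphic_intros)
  have d: "cmod (deriv (\<lambda>z. w1 z - z) z) \<le> c / (cmod z)\<^sup>2" if "R0 \<le> cmod z" "0 < Im z" for z
  proof -
    have "cmod (deriv (\<lambda>z. w1 z - z) z) \<le> Im (w1 z - z) / Im z"
      by (rule norm_deriv_uhp_le[OF holu _ that(2)]) (use Im_w1_ge in simp)
    also have "\<dots> \<le> c / (cmod z)\<^sup>2"
      using F[OF that] Im_w1_le[OF that(2)] that(2) by (simp add: pos_divide_le_eq)
    finally show ?thesis .
  qed
  define R1 where "R1 = R0 + \<bar>x\<bar> + \<bar>y\<bar> + \<bar>a\<bar> + \<bar>b\<bar> + 1"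
  have R1: "R0 \<le> R1" "\<bar>x\<bar> < R1" "\<bar>y\<bar> < R1" "\<bar>a\<bar> < R1" "\<bar>b\<bar> < R1"
    using R0(1) by (auto simp: R1_def)
  have bound: "Re (U (of_real x)) - Re (U (of_real y)) \<le> 4 * c / R" if R: "R1 \<le> R" for R
  proof -
    have Rpos: "0 < R" using R R1 R0 by simp
    have out: "R \<notin> {a..b}" "- R \<notin> {a..b}" using R R1 by auto
    have lim: "((\<lambda>\<epsilon>. U (Complex t \<epsilon>)) \<longlongrightarrow> U (of_real t)) (at_right 0)" if "t \<notin> {a..b}" for t
    proof (rule isCont_tendsto_compose[OF U_isCont[OF that]])
      have "((\<lambda>\<epsilon>. of_real t + \<i> * of_real \<epsilon>) \<longlongrightarrow> of_real t + \<i> * of_real 0) (at_right 0)"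
        by (intro tendsto_intros)
      then show "((\<lambda>\<epsilon>. Complex t \<epsilon>) \<longlongrightarrow> of_real t) (at_right 0)" by (simp add: Complex_eq)
    qed
    \<comment> \<open>\<open>opposite_ends_diff_le\<close> concerns points above the real line;
      continuity of \<open>U\<close> brings its bound down to the line.\<close>
    have "cmod (U (of_real R) - U (of_real (- R))) \<le> 4 * c / R"
    proof (rule tendsto_upperbound)
      show "((\<lambda>\<epsilon>. cmod (U (Complex R \<epsilon>) - U (Complex (- R) \<epsilon>))) \<longlongrightarrow> cmod (U (of_real R) - U (of_real (- R)))) (at_right 0)"
        by (intro tendsto_intros lim out)
      have "\<forall>\<^sub>F \<epsilon> in at_right 0. \<epsilon> \<in> {0<..<R}" using eventually_at_right_real[OF Rpos] .
      then show "\<forall>\<^sub>F \<epsilon> in at_right 0. cmod (U (Complex R \<epsilon>) - U (Complex (- R) \<epsilon>)) \<le> 4 * c / R"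
      proof eventually_elim
        case (elim \<epsilon>)
        have "cmod ((w1 (Complex R \<epsilon>) - Complex R \<epsilon>) - (w1 (Complex (- R) \<epsilon>) - Complex (- R) \<epsilon>)) \<le> 4 * c / R"
          using opposite_ends_diff_le[OF holu Rpos, of c \<epsilon>] d R R1 R0 elim by auto
        then show ?case using U(2) elim by simp
      qed
    qed simp
    then have "Re (U (of_real R) - U (of_real (- R))) \<le> 4 * c / R"
      using complex_Re_le_cmod order_trans by blast
    moreover have "Re (U (of_real x)) \<le> Re (U (of_real R))" by (rule U_mono) (use R R1 assms in auto)
    moreover have "Re (U (of_real (- R))) \<le> Re (U (of_real y))" by (rule U_mono) (use R R1 assms in auto)
    ultimately show ?thesis by simp
  qed
  have "Re (U (of_real x)) - Re (U (of_real y)) \<le> 0"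
  proof (rule tendsto_lowerbound)
    show "((\<lambda>R. 4 * c / R) \<longlongrightarrow> 0) at_top"
      by (intro tendsto_divide_0[OF tendsto_const] filterlim_at_top_imp_at_infinity filterlim_ident)
    show "\<forall>\<^sub>F R in at_top. Re (U (of_real x)) - Re (U (of_real y)) \<le> 4 * c / R"
      using bound eventually_at_top_linorder by blast
  qed simp
  then show ?thesis by simp
qed

text \<open>W(z) = z + U(z) extends \<open>w1\<close>, is open near \<open>x\<close>, and preserves
  the real line and the lower half-plane there. So each s + i \<epsilon> near W(x) is w1(z) with z
  near \<open>x\<close> and 0 < Im z <= \<epsilon>, and G1(s + i \<epsilon>) = G(z) inherits the
  linear bound on Im G.\<close>

lemma shifted_not_in_supp:
  assumes x: "x \<notin> {a..b}"
  shows "x + Re (U (of_real x)) \<notin> supp M1"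
proof -
  obtain \<delta>1 C where C: "0 < \<delta>1" "0 \<le> C"
    and G: "\<And>z. z \<in> ball (of_real x) \<delta>1 \<Longrightarrow> 0 < Im z \<Longrightarrow> - Im (cauchy_transform M z) \<le> C * Im z"
    using M.transforms_Im_le_near_real[OF AE_M x] by metis
  have "complex_of_real x \<in> off_real {a..b}" using x by (simp add: off_real_def)
  then obtain \<delta>2 where \<delta>2: "0 < \<delta>2" "ball (complex_of_real x) \<delta>2 \<subseteq> off_real {a..b}"
    using open_S open_contains_ball by blast
  define B where "B = ball (complex_of_real x) (min \<delta>1 \<delta>2)"
  have B: "B \<subseteq> off_real {a..b}" "B \<subseteq> ball (of_real x) \<delta>1" "of_real x \<in> B" "open B"
    using \<delta>2 C by (auto simp: B_def)
  define W where "W z = z + U z" for z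
  have W: "W z = w1 z" if "0 < Im z" for z using U(2)[OF that] by (simp add: W_def)
  have Wneg: "Im (W z) < 0" if "z \<in> B" "Im z < 0" for z
  proof -
    have "W (cnj z) = cnj (W z)" using U(3)[of z] that B(1) by (auto simp: W_def)
    moreover have "W (cnj z) = w1 (cnj z)" "0 < Im (w1 (cnj z))"
      using W[of "cnj z"] Im_w1_ge[of "cnj z"] that by auto
    ultimately show ?thesis by (metis cnj.simps(2) neg_0_less_iff_less)
  qed
  have W0: "Im (W z) = 0" if "z \<in> B" "Im z = 0" for z
  proof -
    have "z = of_real (Re z)" "Re z \<notin> {a..b}" using that B(1) by (auto simp: off_real_def complex_eq_iff)
    then show ?thesis using U_real[of "Re z"] that by (metis W_def add_0 plus_complex.sel(2))
  qed
  have "open (W ` B)"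
  proof (rule open_mapping_thm[of W B B])
    show "W holomorphic_on B"
      unfolding W_def[abs_def] using holomorphic_on_subset[OF U(1) B(1)] by (intro holomorphic_intros)
    show "connected B" by (simp add: B_def convex_connected)
    define z where "z = Complex x (min \<delta>1 \<delta>2 / 2)"
    have z: "z \<in> B" "0 < Im z"
      using C(1) \<delta>2(1) by (auto simp: z_def B_def dist_norm cmod_def)
    then have "0 < Im (W z)" using W Im_w1_ge by (metis order.strict_trans2)
    moreover have "Im (W (of_real x)) = 0" using W0[OF B(3)] by simp
    ultimately show "\<not> W constant_on B"
      using z B(3) unfolding constant_on_def by (metis less_irrefl)
  qed (use B in auto)
  then obtain \<eta> where \<eta>: "0 < \<eta>" "ball (W (of_real x)) \<eta> \<subseteq> W ` B"
    using B(3) open_contains_ball by blast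
  have Wx: "W (of_real x) = of_real (x + Re (U (of_real x)))"
    using W0[OF B(3)] by (simp add: W_def complex_eq_iff)
  show ?thesis
  proof (rule M1.not_in_supp_if_Im_cauchy_transform_le)
    show "0 < \<eta> / 2" using \<eta> by simp
    fix s \<epsilon> assume s: "\<bar>s - (x + Re (U (of_real x)))\<bar> < \<eta> / 2" and \<epsilon>: "0 < \<epsilon>" "\<epsilon> < \<eta> / 2"
    have "dist (W (of_real x)) (Complex s \<epsilon>) \<le> \<bar>s - (x + Re (U (of_real x)))\<bar> + \<bar>\<epsilon>\<bar>"
      using cmod_le[of "Complex s \<epsilon> - W (of_real x)"] unfolding Wx by (simp add: dist_norm norm_minus_commute)
    then have "Complex s \<epsilon> \<in> ball (W (of_real x)) \<eta>" using s \<epsilon> by simp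
    then obtain z where z: "z \<in> B" "W z = Complex s \<epsilon>" using \<eta>(2) by (metis image_iff subsetD)
    have Imz: "0 < Im z"
      using Wneg[OF z(1)] W0[OF z(1)] z(2) \<epsilon> by (cases "Im z" "0::real" rule: linorder_cases) auto
    have "w1 z = Complex s \<epsilon>" using W[OF Imz] z(2) by simp
    then have G1: "cauchy_transform M1 (Complex s \<epsilon>) = cauchy_transform M z" and le: "Im z \<le> \<epsilon>"
      using F_w1[OF Imz] Im_w1_ge[OF Imz] by (auto simp: F_transform_def)
    have "- Im (cauchy_transform M z) \<le> C * Im z" using G[of z] z(1) B(2) Imz by blast
    also have "\<dots> \<le> C * \<epsilon>" using le C(2) by (intro mult_left_mono)
    finally show "- Im (cauchy_transform M1 (Complex s \<epsilon>)) \<le> C * \<epsilon>" by (simp add: G1)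
  qed
qed

text \<open>From \<open>x\<close> onwards the continuous function s + Re U(s) takes all values above
  its value at \<open>x\<close>, and by \<open>shifted_not_in_supp\<close> none of them lies in the
  support.\<close>

lemma supp_le:
  assumes "b < x" "t \<in> supp M1"
  shows "t \<le> x + Re (U (of_real x))"
proof (rule ccontr)
  assume "\<not> ?thesis"
  then have t: "x + Re (U (of_real x)) < t" by simp
  \<comment> \<open>As \<open>U\<close> is increasing, \<open>X\<close> is far enough to the right:
    X + Re U(X) is at least \<open>t\<close>.\<close>
  define X where "X = t - Re (U (of_real x))"
  have X: "x \<le> X" using t by (simp add: X_def)
  have "Re (U (of_real x)) \<le> Re (U (of_real X))" by (rule U_mono) (use X assms in auto)
  then have "t \<le> X + Re (U (of_real X))" by (simp add: X_def)
  then have "\<exists>s. x \<le> s \<and> s \<le> X \<and> s + Re (U (of_real s)) = t"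
  proof (rule IVT'[of "\<lambda>s. s + Re (U (of_real s))", OF less_imp_le[OF t] _ X])
    show "continuous_on {x..X} (\<lambda>s. s + Re (U (complex_of_real s)))"
      using assms(1)
      by (intro continuous_on_add continuous_on_id continuous_on_Re
          continuous_on_compose2[OF holomorphic_on_imp_continuous_on[OF U(1)]] continuous_on_of_real)
        (auto simp: off_real_def)
  qed
  then obtain s where "x \<le> s" "s + Re (U (of_real s)) = t" by blast
  then show False using shifted_not_in_supp[of s] assms by auto
qed

lemma supp_ge:
  assumes "y < a" "t \<in> supp M1"
  shows "y + Re (U (of_real y)) \<le> t"
proof (rule ccontr)
  assume "\<not> ?thesis"
  then have t: "t < y + Re (U (of_real y))" by simp
  define Y where "Y = t - Re (U (of_real y))"
  have Y: "Y \<le> y" using t by (simp add: Y_def)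
  have "Re (U (of_real Y)) \<le> Re (U (of_real y))" by (rule U_mono) (use Y assms in auto)
  then have "Y + Re (U (of_real Y)) \<le> t" by (simp add: Y_def)
  then have "\<exists>s. Y \<le> s \<and> s \<le> y \<and> s + Re (U (of_real s)) = t"
  proof (rule IVT'[of "\<lambda>s. s + Re (U (of_real s))", OF _ less_imp_le[OF t] Y])
    show "continuous_on {Y..y} (\<lambda>s. s + Re (U (complex_of_real s)))"
      using assms(1)
      by (intro continuous_on_add continuous_on_id continuous_on_Re
          continuous_on_compose2[OF holomorphic_on_imp_continuous_on[OF U(1)]] continuous_on_of_real)
        (auto simp: off_real_def)
  qed
  then obtain s where "s \<le> y" "s + Re (U (of_real s)) = t" by blast
  then show False using shifted_not_in_supp[of s] assms by auto
qed

text \<open>By \<open>U_right_le_left\<close> the right end is displaced by no more than the left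
  end, so the enclosing interval does not get longer.\<close>

lemma supp_diff_le:
  assumes "s \<in> supp M1" "t \<in> supp M1"
  shows "s - t \<le> b - a"
proof (rule field_le_epsilon)
  fix e :: real assume e: "0 < e"
  have "s \<le> (b + e/2) + Re (U (of_real (b + e/2)))" by (rule supp_le) (use e assms in auto)
  moreover have "(a - e/2) + Re (U (of_real (a - e/2))) \<le> t" by (rule supp_ge) (use e assms in auto)
  moreover have "Re (U (of_real (b + e/2))) \<le> Re (U (of_real (a - e/2)))"
    by (rule U_right_le_left) (use e in auto)
  ultimately show "s - t \<le> b - a + e" by simp
qed

text \<open>Equality leaves no room in the estimates behind \<open>supp_diff_le\<close>: Re U(x') <=
  Re U(x) up to any error, for all x and x' right of \<open>b\<close>. So \<open>U\<close> is
  constant on that half-line, and the identity theorem makes \<open>w1\<close> a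
  translation.\<close>

lemma displacement_constant:
  assumes "s \<in> supp M1" "t \<in> supp M1" "s - t = b - a"
  shows "\<exists>L. Im L = 0 \<and> (\<forall>z. 0 < Im z \<longrightarrow> w1 z = z + L)"
proof -
  define L where "L = U (of_real (b + 1))"
  have le: "Re (U (of_real x')) \<le> Re (U (of_real x))" if x: "b < x" "b < x'" for x x'
  proof (rule field_le_epsilon)
    fix e :: real assume e: "0 < e"
    \<comment> \<open>\<open>y\<close> is close to \<open>b\<close>, so that little is lost in
      \<open>supp_le\<close>, and not beyond \<open>x\<close>, so that monotonicity applies.\<close>
    define y where "y = min x (b + e/2)"
    have y: "b < y" "y \<le> x" "y \<le> b + e/2" using x e by (auto simp: y_def)
    have "s \<le> y + Re (U (of_real y))" by (rule supp_le) (use y assms in auto)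
    moreover have "Re (U (of_real y)) \<le> Re (U (of_real x))" by (rule U_mono) (use y in auto)
    moreover have "(a - e/2) + Re (U (of_real (a - e/2))) \<le> t" by (rule supp_ge) (use e assms in auto)
    moreover have "Re (U (of_real x')) \<le> Re (U (of_real (a - e/2)))"
      by (rule U_right_le_left) (use e x in auto)
    ultimately show "Re (U (of_real x')) \<le> Re (U (of_real x)) + e" using assms(3) y by simp
  qed
  have UL: "U (of_real x) = L" if "b < x" for x
    unfolding L_def using le[of x "b + 1"] le[of "b + 1" x] U_real[of x] U_real[of "b + 1"] that
    by (intro complex_eqI) auto
  \<comment> \<open>This disc right of \<open>b\<close> meets both the real line, where
    \<open>U = L\<close> is known, and the half-plane, where U(z) = w1(z) - z.\<close>
  define B where "B = ball (complex_of_real (b + 1)) 1"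
  have Bb: "b < Re z" if "z \<in> B" for z
    using that abs_Re_le_cmod[of "of_real (b + 1) - z"] by (auto simp: B_def dist_norm)
  have Bsub: "B \<subseteq> off_real {a..b}" using Bb by (force simp: off_real_def)
  have UB: "U z - L = 0" if "z \<in> B" for z
  proof (rule analytic_continuation[of "\<lambda>z. U z - L" B "of_real ` {b<..<b+2}" "of_real (b + 1)"])
    show "(\<lambda>z. U z - L) holomorphic_on B"
      using holomorphic_on_subset[OF U(1) Bsub] by (intro holomorphic_intros)
    show "connected B" by (simp add: B_def convex_connected)
    show "complex_of_real ` {b<..<b + 2} \<subseteq> B" 
      by (auto simp: B_def dist_of_real dist_real_def simp del: of_real_add)
    show "complex_of_real (b + 1) islimpt complex_of_real ` {b<..<b + 2}"
      unfolding islimpt_approachable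
    proof (intro allI impI)
      fix e :: real assume e: "0 < e"
      define h where "h = min (1/2) (e/2)"
      have h: "0 < h" "h < 1" "h < e" using e by (auto simp: h_def min_def)
      have "dist (complex_of_real (b + 1 + h)) (of_real (b + 1)) = h"
        using h by (simp add: dist_of_real dist_real_def del: of_real_add)
      then show "\<exists>x'\<in>complex_of_real ` {b<..<b + 2}. x' \<noteq> of_real (b + 1) \<and> dist x' (of_real (b + 1)) < e"
        using h by (intro bexI[of _ "complex_of_real (b + 1 + h)"] imageI) (auto simp: complex_eq_iff)
    qed
  qed (use that UL in \<open>auto simp: B_def\<close>)
  have "w1 z - z = L" if z: "0 < Im z" for z
  proof (rule analytic_continuation_open[of "B \<inter> \<H>" \<H> "\<lambda>z. w1 z - z" "\<lambda>_. L"])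
    show "B \<inter> \<H> \<noteq> {}"
    proof -
      have "Complex (b + 1) (1/2) \<in> B \<inter> \<H>" by (auto simp: B_def dist_norm cmod_def)
      then show ?thesis by blast
    qed
    show "w1 z - z = L" if "z \<in> B \<inter> \<H>" for z using UB[of z] U(2)[of z] that by simp
  qed (use z open_uhp connected_uhp hol_w1 in \<open>auto simp: B_def intro!: holomorphic_intros\<close>)
  then show ?thesis
    using U_real[of "b + 1"] by (intro exI[of _ L]) (auto simp: L_def algebra_simps)
qed

end

end

section \<open>Dirac masses and the diameter of the support\<close>

lemma (in real_distribution) eq_return_if_AE:
  assumes "AE t in M. t = c"
  shows "M = return borel c"
proof (rule measure_eqI)
  fix A assume "A \<in> sets M"
  then have A: "A \<in> sets borel" by simp
  show "emeasure M A = emeasure (return borel c) A"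
  proof (cases "c \<in> A")
    case True
    then have "AE t in M. t \<in> A" using assms by auto
    then have "emeasure M A = 1" using A by (simp add: emeasure_eq_1_AE)
    then show ?thesis using True A by simp
  next
    case False
    then have "AE t in M. t \<notin> A" using assms by auto
    then have "emeasure M A = 0" using A by (subst (asm) AE_iff_measurable[of A]) auto
    then show ?thesis using False A by simp
  qed
qed simp

text \<open>At z = c + i, - Im G(z) is the mean of 1 / ((c - t)^2 + 1). The hypothesis makes it 1,
  the maximum of the integrand, which is attained only at t = c.\<close>

lemma (in real_distribution) dirac_if_F_transform_translation:
  assumes "F_transform M (Complex c 1) = \<i>"
  shows "M = return borel c"
proof -
  define z where "z = Complex c 1"
  have z: "z \<in> off_real UNIV" by (simp add: off_real_def z_def)
  define f where "f t = (cmod (1 / (z - complex_of_real t)))\<^sup>2" for t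
  have f: "f t = 1 / ((c - t)\<^sup>2 + 1)" for t
    by (simp add: f_def z_def norm_divide power_divide cmod_power2)
  have f1: "f t \<le> 1" for t by (simp add: f divide_le_eq_1 add_nonneg_pos)
  have int: "integrable M f"
    unfolding f_def using integrable_resolvent_powers(3)[OF _ _ z] by simp
  have "cauchy_transform M z = 1 / F_transform M z" by (simp add: F_transform_def)
  also have "\<dots> = - \<i>" using assms by (simp add: z_def)
  finally have "cauchy_transform M z = - \<i>" .
  then have "integral\<^sup>L M f = 1"
    using Im_cauchy_transform[OF _ _ z] by (simp add: f_def[abs_def] z_def)
  then have "(\<integral>t. 1 - f t \<partial>M) = 0" using int prob_space by simp
  then have "AE t in M. 1 - f t = 0"
    using integral_nonneg_eq_0_iff_AE[of M "\<lambda>t. 1 - f t"] int f1 by simp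
  then have "AE t in M. t = c" by eventually_elim (simp add: f divide_eq_1_iff)
  then show ?thesis by (rule eq_return_if_AE)
qed

section \<open>Free convolution with Dirac masses\<close>

lemma F_transform_return: "F_transform (return borel c) z = z - complex_of_real c"
proof -
  have "cauchy_transform (return borel c) z = 1 / (z - complex_of_real c)"
    unfolding cauchy_transform_def by (subst integral_return) auto
  then show ?thesis by (simp add: F_transform_def)
qed

lemma free_add_conv_of_commute: "free_add_conv_of M M1 M2 \<Longrightarrow> free_add_conv_of M M2 M1"
  unfolding free_add_conv_of_def by (metis add.commute)

lemma real_prob_measure_return: "real_prob_measure (return borel c)"
  by (simp add: real_prob_measure_def prob_space_return)

lemma voiculescu_return:
  assumes "voiculescu_on (return borel c) \<alpha> \<beta> a b" "z \<in> Gamma_cone \<alpha> \<beta>"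
  shows "voiculescu (return borel c) a b z = of_real c"
proof -
  have "z \<in> F_transform (return borel c) ` Gamma_cone a b"
    using assms by (auto simp: voiculescu_on_def)
  then have "inv_into (Gamma_cone a b) (F_transform (return borel c)) z - of_real c = z"
    using f_inv_into_f F_transform_return by metis
  then show ?thesis by (simp add: voiculescu_def algebra_simps)
qed

text \<open>Preimages under F are translates by \<open>c\<close>. The cone is widened by |c| /
  \<beta>, because |c| <= (|c| / \<beta>) Im z when Im z > \<beta>.\<close>

lemma voiculescu_on_return:
  assumes "0 < \<alpha>" "0 < \<beta>"
  shows "voiculescu_on (return borel c) \<alpha> \<beta> (\<alpha> + \<bar>c\<bar> / \<beta>) \<beta>"
  unfolding voiculescu_on_def
proof (intro conjI subsetI)
  show "0 < \<alpha> + \<bar>c\<bar> / \<beta>" using assms by (simp add: add_pos_nonneg)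
  show "inj_on (F_transform (return borel c)) (Gamma_cone (\<alpha> + \<bar>c\<bar> / \<beta>) \<beta>)"
    by (auto simp: F_transform_return inj_on_def)
  fix z assume z: "z \<in> Gamma_cone \<alpha> \<beta>"
  have "\<bar>Re z + c\<bar> < (\<alpha> + \<bar>c\<bar> / \<beta>) * Im z"
  proof -
    have "\<bar>Re z + c\<bar> \<le> \<bar>Re z\<bar> + \<bar>c\<bar> / \<beta> * \<beta>" using assms abs_triangle_ineq[of "Re z" c] by simp
    also have "\<dots> < \<alpha> * Im z + \<bar>c\<bar> / \<beta> * Im z"
      using z assms by (intro add_less_le_mono mult_left_mono) (auto simp: Gamma_cone_def)
    finally show ?thesis by (simp add: algebra_simps)
  qed
  then have "z + of_real c \<in> Gamma_cone (\<alpha> + \<bar>c\<bar> / \<beta>) \<beta>"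
    using z by (simp add: Gamma_cone_def)
  then show "z \<in> F_transform (return borel c) ` Gamma_cone (\<alpha> + \<bar>c\<bar> / \<beta>) \<beta>"
    by (intro image_eqI[of _ _ "z + of_real c"]) (auto simp: F_transform_return)
qed (use assms in auto)

text \<open>The Voiculescu transform of the Dirac mass is the constant \<open>c\<close>; moved to
  the other side it becomes that of the mass at \<open>- c\<close>, on the same cone.\<close>

lemma free_add_conv_of_return_inverse:
  assumes "free_add_conv_of M M1 (return borel c)"
  shows "free_add_conv_of M1 M (return borel (- c))"
proof -
  obtain \<alpha> \<beta> a b a1 b1 a2 b2 where ab: "\<alpha> > 0" "\<beta> > 0"
    and V: "voiculescu_on M \<alpha> \<beta> a b" and V1: "voiculescu_on M1 \<alpha> \<beta> a1 b1"
    and V2: "voiculescu_on (return borel c) \<alpha> \<beta> a2 b2"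
    and eq: "\<And>z. z \<in> Gamma_cone \<alpha> \<beta> \<Longrightarrow>
      voiculescu M a b z = voiculescu M1 a1 b1 z + voiculescu (return borel c) a2 b2 z"
    using assms unfolding free_add_conv_of_def by blast
  note V' = voiculescu_on_return[OF ab, of "- c"]
  have "voiculescu M1 a1 b1 z = voiculescu M a b z
      + voiculescu (return borel (- c)) (\<alpha> + \<bar>- c\<bar> / \<beta>) \<beta> z" if "z \<in> Gamma_cone \<alpha> \<beta>" for z
    using eq[OF that] voiculescu_return[OF V2 that] voiculescu_return[OF V' that] by simp
  then show ?thesis
    unfolding free_add_conv_of_def using ab V V1 V' by blast
qed

text \<open>The displacement estimates are applied to the first subordination function. Compactness
  of \<open>supp M1\<close> is recorded so that the lemma can be used again with \<open>M\<close>
  and \<open>M1\<close> exchanged.\<close>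

lemma free_summand_diam:
  assumes M: "real_prob_measure M" and M1: "real_prob_measure M1" and M2: "real_prob_measure M2"
    and comp: "compact (supp M)" and conv: "free_add_conv_of M M1 M2"
  shows "compact (supp M1)" and "diam (supp M1) \<le> diam (supp M)"
    and "diam (supp M1) = diam (supp M) \<Longrightarrow> is_dirac M2"
proof -
  note D = M[unfolded real_prob_measure_iff] M1[unfolded real_prob_measure_iff] M2[unfolded real_prob_measure_iff]
  obtain a b where ab: "a \<in> supp M" "b \<in> supp M" "supp M \<subseteq> {a..b}"
    using compact_supp_bounds[OF comp real_distribution.supp_nonempty[OF D(1)]] .
  obtain w1 w2 where w1: "w1 holomorphic_on \<H>" "\<And>z. 0 < Im z \<Longrightarrow> Im z \<le> Im (w1 z)"
      "\<And>z. 0 < Im z \<Longrightarrow> F_transform M1 (w1 z) = F_transform M z"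
    and w2: "w2 holomorphic_on \<H>" "\<And>z. 0 < Im z \<Longrightarrow> Im z \<le> Im (w2 z)"
      "\<And>z. 0 < Im z \<Longrightarrow> F_transform M2 (w2 z) = F_transform M z"
    and sum: "\<And>z. 0 < Im z \<Longrightarrow> w1 z + w2 z = z + F_transform M z"
    by (rule free_add_conv_subordination[OF D conv]) (rule that)
  have Im_w1_le: "Im (w1 z) \<le> Im (F_transform M z)" if "0 < Im z" for z
    using arg_cong[OF sum[OF that], of Im] w2(2)[OF that] by simp
  have AE: "AE t in M. t \<in> {a..b}"
    using real_distribution.AE_supp[OF D(1)] ab(3) by (auto elim!: eventually_mono)
  interpret subordinate_compact M M1 a b w1
    using D(1,2) AE w1 Im_w1_le by (simp add: subordinate_compact_def subordinate_compact_axioms_def)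
  obtain U where U: "U holomorphic_on off_real {a..b}" "\<And>z. 0 < Im z \<Longrightarrow> U z = w1 z - z"
    "\<And>z. z \<in> off_real {a..b} \<Longrightarrow> U (cnj z) = cnj (U z)"
    by (rule displacement_extension) (rule that)
  have diff: "s - t \<le> b - a" if "s \<in> supp M1" "t \<in> supp M1" for s t
    by (rule supp_diff_le[OF U that])
  obtain t0 where t0: "t0 \<in> supp M1" using M1.supp_nonempty by blast
  have "supp M1 \<subseteq> {t0 - (b - a)..t0 + (b - a)}" using diff[OF t0] diff[OF _ t0] by fastforce
  then show comp1: "compact (supp M1)"
    using closed_supp by (meson bounded_closed_interval bounded_subset compact_eq_bounded_closed)
  have dM: "diam (supp M) = ereal (b - a)" by (rule diam_eq[OF ab])
  show "diam (supp M1) \<le> diam (supp M)" unfolding dM by (rule diam_le) (rule diff)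
  assume eq: "diam (supp M1) = diam (supp M)"
  obtain a1 b1 where ab1: "a1 \<in> supp M1" "b1 \<in> supp M1" "supp M1 \<subseteq> {a1..b1}"
    using compact_supp_bounds[OF comp1 M1.supp_nonempty] .
  have "b1 - a1 = b - a" using eq diam_eq[OF ab1] dM by simp
  then obtain L where L: "Im L = 0" "\<And>z. 0 < Im z \<Longrightarrow> w1 z = z + L"
    using displacement_constant[OF U ab1(2,1)] by blast
  \<comment> \<open>With w1 = z + L, the relations w1 + w2 = z + F and F2(w2) = F leave F2(w2) = w2
    + L. The image of \<open>w2\<close> is open, so the identity theorem extends this to the
    half-plane.\<close>
  have F2: "F_transform M2 v = v + L" if v: "v \<in> w2 ` \<H>" for v
  proof -
    obtain z where z: "v = w2 z" "0 < Im z" using v by blast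
    show ?thesis using sum[OF z(2)] w2(3)[OF z(2)] L(2)[OF z(2)] z(1) by (simp add: algebra_simps)
  qed
  have "open (w2 ` \<H>)"
  proof (rule open_mapping_thm[OF w2(1) open_uhp connected_uhp open_uhp order_refl])
    show "\<not> w2 constant_on \<H>"
    proof
      assume "w2 constant_on \<H>"
      then obtain k where k: "\<And>z. 0 < Im z \<Longrightarrow> w2 z = k" unfolding constant_on_def by auto
      \<comment> \<open>A test point higher than the supposed constant value contradicts Im w2(z) >=
        Im z.\<close>
      have "Im (Complex 0 (\<bar>Im k\<bar> + 1)) \<le> Im k" using w2(2)[of "Complex 0 (\<bar>Im k\<bar> + 1)"] k by simp
      then show False by simp
    qed
  qed
  moreover have "w2 ` \<H> \<noteq> {}" by (auto intro!: exI[of _ \<i>])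
  moreover have "w2 ` \<H> \<subseteq> \<H>" using w2(2) by (auto intro: less_le_trans)
  ultimately have "F_transform M2 v = v + L" if "0 < Im v" for v
    by (rule analytic_continuation_open[OF _ open_uhp _ connected_uhp])
      (use that F2 real_distribution.F_transform_holomorphic[OF D(3)] in \<open>auto intro!: holomorphic_intros\<close>)
  then have "F_transform M2 (Complex (- Re L) 1) = \<i>" using L(1) by (simp add: complex_eq_iff)
  then have "M2 = return borel (- Re L)"
    using real_distribution.dirac_if_F_transform_translation[OF D(3)] by blast
  then show "is_dirac M2" by (auto simp: is_dirac_def)
qed

text \<open>\<open>M1\<close> is in turn the convolution of \<open>M\<close> with the opposite Dirac
  mass, so the diameter inequality holds in both directions.\<close>

lemma diam_free_summand_eq_if_dirac:
  assumes "real_prob_measure M" "real_prob_measure M1" "compact (supp M)"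
    and "free_add_conv_of M M1 M2" "is_dirac M2"
  shows "diam (supp M1) = diam (supp M)"
proof -
  obtain c where c: "M2 = return borel c" using assms(5) by (auto simp: is_dirac_def)
  have conv: "free_add_conv_of M1 M (return borel (- c))"
    using free_add_conv_of_return_inverse assms(4) by (simp add: c)
  have M2: "real_prob_measure M2" unfolding c by (rule real_prob_measure_return)
  note M1 = free_summand_diam[OF assms(1,2) M2 assms(3,4)]
  have "diam (supp M) \<le> diam (supp M1)"
    by (rule free_summand_diam(2)[OF assms(2,1) real_prob_measure_return M1(1) conv])
  with M1(2) show ?thesis by (rule antisym)
qed

theorem theorem3p2:
  fixes \<mu> \<mu>1 \<mu>2 :: "real measure"
  assumes "real_prob_measure \<mu>" and "real_prob_measure \<mu>1" and "real_prob_measure \<mu>2"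
    and "compact (supp \<mu>)"
    and "free_add_conv_of \<mu> \<mu>1 \<mu>2"
  shows "diam (supp \<mu>1) \<le> diam (supp \<mu>) \<and> diam (supp \<mu>2) \<le> diam (supp \<mu>)
     \<and> (diam (supp \<mu>1) = diam (supp \<mu>) \<longleftrightarrow> is_dirac \<mu>2)
     \<and> (diam (supp \<mu>2) = diam (supp \<mu>) \<longleftrightarrow> is_dirac \<mu>1)"
proof -
  note conv' = free_add_conv_of_commute[OF assms(5)]
  show ?thesis
    using free_summand_diam(2,3)[OF assms] free_summand_diam(2,3)[OF assms(1,3,2,4) conv']
      diam_free_summand_eq_if_dirac[OF assms(1,2,4,5)] diam_free_summand_eq_if_dirac[OF assms(1,3,4) conv']
    by blast
qed

end
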